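(* Let $A$ be a short local algebra of Hilbert type $(e,e-1)$ with $e\ge2$. Let $x$ be a left Conca element in $A$, and let $P_\bullet=(P_i,d_i)_{i\in\mathbb Z}$ with $P_i={}_AA$ and $d_i=r(x)\colon{}_AA\to{}_AA$ for all $i\in\mathbb Z$. Then $P_\bullet$ is a minimal exact complex of projective modules with all images being equal to $Ax$. In particular, $P_\bullet$ is a complex of type I. If $x$ is a Conca element, then also $P_\bullet^*$ is exact, thus $Ax$ is Gorenstein-projective.
   Context: Let $k$ be a field. All algebras $A$ are finite-dimensional local (not necessarily commutative) $k$-algebras with radical $J$ such that $A/J=k$. $A$ is short if $J^3=0$. $|M|$ denotes the length of a module $M$. The Hilbert type of a short local algebra is $(|J/J^2|,|J^2|)$. Modules are left $A$-modules of finite length. A non-zero element $x\in A$ is a left Conca element if $x^2=0$ and $J^2=Jx$; it is a Conca element if $x^2=0$ and $J^2=Jx=xJ$. $r(x)\colon{}_AA\to{}_AA$ is right multiplication by $x$, $r(x)(c)=cx$. An exact complex of projective modules is a $\mathbb Z$-indexed sequence $(P_i,d_i\colon P_i\to P_{i-1})_{i\in\mathbb Z}$ with $P_i$ projective and $\operatorname{Im}d_i=\operatorname{Ker}d_{i-1}$ for all $i$; its images are the modules $\operatorname{Im}d_i$. It is minimal if each $d_i$ maps into $JP_{i-1}$. $P_\bullet^*$ is obtained by applying $\operatorname{Hom}_A(-,{}_AA)$ to the modules and maps of $P_\bullet$. A complex of type I is a non-zero minimal exact complex of projective modules in which all $P_i$ have the same rank. A module is Gorenstein-projective if it is an image in an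 exact complex $P_\bullet$ of projective modules such that $P_\bullet^*$ is again exact. *)

theory Defs
  imports
    "HOL-Algebra.Module"
    "HOL-Algebra.QuotRing"
    "HOL-Algebra.Ideal_Product"
    "HOL-Library.Extended_Nat"
begin

section \<open>Left modules over a not necessarily commutative ring\<close>

text \<open>The library locale \<open>module\<close> requires a commutative ring; \<open>left_module\<close> has the same axioms
  over an arbitrary ring. The library predicate \<open>submodule\<close> needs no commutativity. In records of
  type \<open>module\<close> that do not come from a ring the fields \<open>mult\<close> and \<open>one\<close> are irrelevant.\<close>

locale left_module = R?: ring R + M?: abelian_group M
  for R :: "('a, 'r) ring_scheme" (structure) and M :: "('a, 'm) module" (structure) +
  assumes smult_closed [simp, intro]:
      "\<lbrakk>a \<in> carrier R; x \<in> carrier M\<rbrakk> \<Longrightarrow> a \<odot>\<^bsub>M\<^esub> x \<in> carrier M"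
    and smult_l_distr:
      "\<lbrakk>a \<in> carrier R; b \<in> carrier R; x \<in> carrier M\<rbrakk> \<Longrightarrow>
        (a \<oplus>\<^bsub>R\<^esub> b) \<odot>\<^bsub>M\<^esub> x = a \<odot>\<^bsub>M\<^esub> x \<oplus>\<^bsub>M\<^esub> b \<odot>\<^bsub>M\<^esub> x"
    and smult_r_distr:
      "\<lbrakk>a \<in> carrier R; x \<in> carrier M; y \<in> carrier M\<rbrakk> \<Longrightarrow>
        a \<odot>\<^bsub>M\<^esub> (x \<oplus>\<^bsub>M\<^esub> y) = a \<odot>\<^bsub>M\<^esub> x \<oplus>\<^bsub>M\<^esub> a \<odot>\<^bsub>M\<^esub> y"
    and smult_assoc:
      "\<lbrakk>a \<in> carrier R; b \<in> carrier R; x \<in> carrier M\<rbrakk> \<Longrightarrow>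
        (a \<otimes>\<^bsub>R\<^esub> b) \<odot>\<^bsub>M\<^esub> x = a \<odot>\<^bsub>M\<^esub> (b \<odot>\<^bsub>M\<^esub> x)"
    and smult_one [simp]: "x \<in> carrier M \<Longrightarrow> \<one>\<^bsub>R\<^esub> \<odot>\<^bsub>M\<^esub> x = x"

definition left_regular :: "('a, 'r) ring_scheme \<Rightarrow> ('a, 'a) module" where
  "left_regular A =
    \<lparr>carrier = carrier A, mult = mult A, one = one A, zero = zero A, add = add A,
     smult = mult A\<rparr>"

text \<open>\<open>A\<^sup>n\<close>, realised on the sequences that vanish from index \<open>n\<close> on.\<close>

definition free_module :: "('a, 'r) ring_scheme \<Rightarrow> nat \<Rightarrow> ('a, nat \<Rightarrow> 'a) module" where
  "free_module A n =
    \<lparr>carrier = {f. (\<forall>i<n. f i \<in> carrier A) \<and> (\<forall>i\<ge>n. f i = \<zero>\<^bsub>A\<^esub>)},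
     mult = undefined, one = undefined,
     zero = (\<lambda>_. \<zero>\<^bsub>A\<^esub>), add = (\<lambda>f g i. f i \<oplus>\<^bsub>A\<^esub> g i),
     smult = (\<lambda>a f i. a \<otimes>\<^bsub>A\<^esub> f i)\<rparr>"

definition quot_module :: "('a, 'm) module \<Rightarrow> 'm set \<Rightarrow> ('a, 'm set) module" where
  "quot_module M N =
    \<lparr>carrier = a_rcosets\<^bsub>M\<^esub> N, mult = undefined, one = undefined,
     zero = N, add = set_add M,
     smult = (\<lambda>a C. N <+>\<^bsub>M\<^esub> ((\<lambda>c. a \<odot>\<^bsub>M\<^esub> c) ` C))\<rparr>"

definition lmod_hom ::
    "('a, 'r) ring_scheme \<Rightarrow> ('a, 'm) module \<Rightarrow> ('a, 'n) module \<Rightarrow> ('m \<Rightarrow> 'n) set" where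
  "lmod_hom R M N =
    {h. h \<in> carrier M \<rightarrow> carrier N \<and>
        (\<forall>x\<in>carrier M. \<forall>y\<in>carrier M. h (x \<oplus>\<^bsub>M\<^esub> y) = h x \<oplus>\<^bsub>N\<^esub> h y) \<and>
        (\<forall>a\<in>carrier R. \<forall>x\<in>carrier M. h (a \<odot>\<^bsub>M\<^esub> x) = a \<odot>\<^bsub>N\<^esub> h x)}"

definition lmod_isomorphic ::
    "('a, 'r) ring_scheme \<Rightarrow> ('a, 'm) module \<Rightarrow> ('a, 'n) module \<Rightarrow> bool" where
  "lmod_isomorphic R M N \<longleftrightarrow> (\<exists>h\<in>lmod_hom R M N. bij_betw h (carrier M) (carrier N))"

text \<open>The length is the supremum of the lengths of strict chains
  \<open>N 0 \<subset> N 1 \<subset> \<dots> \<subset> N n\<close> of submodules.\<close>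

definition mod_length :: "('a, 'r) ring_scheme \<Rightarrow> ('a, 'm) module \<Rightarrow> enat" where
  "mod_length R M =
    Sup {enat n | n. \<exists>N :: nat \<Rightarrow> 'm set.
      (\<forall>i\<le>n. submodule (N i) R M) \<and> (\<forall>i<n. N i \<subset> N (Suc i))}"

text \<open>All modules considered are of finite length, so a projective module is a direct summand of a free
  module of finite rank.\<close>

definition projective_module :: "('a, 'r) ring_scheme \<Rightarrow> ('a, 'm) module \<Rightarrow> bool" where
  "projective_module R P \<longleftrightarrow> left_module R P \<and>
    (\<exists>n. \<exists>s\<in>lmod_hom R P (free_module R n). \<exists>p\<in>lmod_hom R (free_module R n) P.
      \<forall>x\<in>carrier P. p (s x) = x)"

text \<open>Over a local ring every finitely generated projective module is free.\<close>

definition has_rank :: "('a, 'r) ring_scheme \<Rightarrow> ('a, 'm) module \<Rightarrow> nat \<Rightarrow> bool" where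
  "has_rank R P n \<longleftrightarrow> lmod_isomorphic R P (free_module R n)"

section \<open>Short local algebras\<close>

definition maximal_left_ideal :: "'a set \<Rightarrow> ('a, 'r) ring_scheme \<Rightarrow> bool" where
  "maximal_left_ideal I A \<longleftrightarrow>
    submodule I A (left_regular A) \<and> I \<noteq> carrier A \<and>
    (\<forall>L. submodule L A (left_regular A) \<longrightarrow> I \<subseteq> L \<longrightarrow> L = I \<or> L = carrier A)"

definition radical :: "('a, 'r) ring_scheme \<Rightarrow> 'a set" where
  "radical A = carrier A \<inter> \<Inter> {I. maximal_left_ideal I A}"

abbreviation radical_sq :: "('a, 'r) ring_scheme \<Rightarrow> 'a set" where
  "radical_sq A \<equiv> ideal_prod A (radical A) (radical A)"

text \<open>A \<open>k\<close>-algebra \<open>A\<close> is a ring record with a scalar multiplication by \<open>k\<close>. The condition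
  \<open>A/J = k\<close> says that the canonical map \<open>k \<rightarrow> A/J\<close> is bijective.\<close>

locale local_algebra =
  fixes K :: "'k ring" and A :: "('k, 'a) module"
  assumes field_K: "field K"
    and ring_A: "ring A"
    and vector_space_A: "Module.module K A"
    and smult_mult_left: "\<lbrakk>c \<in> carrier K; a \<in> carrier A; b \<in> carrier A\<rbrakk> \<Longrightarrow>
      (c \<odot>\<^bsub>A\<^esub> a) \<otimes>\<^bsub>A\<^esub> b = c \<odot>\<^bsub>A\<^esub> (a \<otimes>\<^bsub>A\<^esub> b)"
    and smult_mult_right: "\<lbrakk>c \<in> carrier K; a \<in> carrier A; b \<in> carrier A\<rbrakk> \<Longrightarrow>
      a \<otimes>\<^bsub>A\<^esub> (c \<odot>\<^bsub>A\<^esub> b) = c \<odot>\<^bsub>A\<^esub> (a \<otimes>\<^bsub>A\<^esub> b)"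
    and finite_dim: "\<exists>B. finite B \<and> B \<subseteq> carrier A \<and>
      (\<forall>a\<in>carrier A. \<exists>c\<in>B \<rightarrow> carrier K. a = finsum A (\<lambda>b. c b \<odot>\<^bsub>A\<^esub> b) B)"
    and local: "\<exists>!I. maximal_left_ideal I A"
    and residue_field: "bij_betw (\<lambda>c. radical A +>\<^bsub>A\<^esub> (c \<odot>\<^bsub>A\<^esub> \<one>\<^bsub>A\<^esub>))
      (carrier K) (carrier (A Quot radical A))"

locale short_local_algebra = local_algebra +
  assumes short: "ideal_prod A (radical_sq A) (radical A) = {\<zero>\<^bsub>A\<^esub>}"

definition hilbert_type :: "('a, 'r) ring_scheme \<Rightarrow> enat \<times> enat" where
  "hilbert_type A =
    (mod_length A (quot_module ((left_regular A)\<lparr>carrier := radical A\<rparr>) (radical_sq A)),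
     mod_length A ((left_regular A)\<lparr>carrier := radical_sq A\<rparr>))"

text \<open>\<open>I #> x\<close> is the set \<open>{c x | c \<in> I}\<close>, and \<open>x <# I\<close> is \<open>{x c | c \<in> I}\<close>.\<close>

definition left_conca :: "('a, 'r) ring_scheme \<Rightarrow> 'a \<Rightarrow> bool" where
  "left_conca A x \<longleftrightarrow> x \<in> carrier A \<and> x \<noteq> \<zero>\<^bsub>A\<^esub> \<and> x \<otimes>\<^bsub>A\<^esub> x = \<zero>\<^bsub>A\<^esub> \<and>
    radical_sq A = radical A #>\<^bsub>A\<^esub> x"

definition conca :: "('a, 'r) ring_scheme \<Rightarrow> 'a \<Rightarrow> bool" where
  "conca A x \<longleftrightarrow> x \<in> carrier A \<and> x \<noteq> \<zero>\<^bsub>A\<^esub> \<and> x \<otimes>\<^bsub>A\<^esub> x = \<zero>\<^bsub>A\<^esub> \<and>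
    radical_sq A = radical A #>\<^bsub>A\<^esub> x \<and> radical_sq A = x <#\<^bsub>A\<^esub> radical A"

definition right_mult :: "('a, 'r) ring_scheme \<Rightarrow> 'a \<Rightarrow> 'a \<Rightarrow> 'a" where
  "right_mult A x c = c \<otimes>\<^bsub>A\<^esub> x"

section \<open>Complexes\<close>

definition exact_complex ::
    "('a, 'r) ring_scheme \<Rightarrow> (int \<Rightarrow> ('a, 'm) module) \<Rightarrow> (int \<Rightarrow> 'm \<Rightarrow> 'm) \<Rightarrow> bool" where
  "exact_complex R P d \<longleftrightarrow>
    (\<forall>i. left_module R (P i)) \<and>
    (\<forall>i. d i \<in> lmod_hom R (P i) (P (i - 1))) \<and>
    (\<forall>i. d i ` carrier (P i) = a_kernel (P (i - 1)) (P (i - 2)) (d (i - 1)))"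

definition exact_projective_complex ::
    "('a, 'r) ring_scheme \<Rightarrow> (int \<Rightarrow> ('a, 'm) module) \<Rightarrow> (int \<Rightarrow> 'm \<Rightarrow> 'm) \<Rightarrow> bool" where
  "exact_projective_complex R P d \<longleftrightarrow> exact_complex R P d \<and> (\<forall>i. projective_module R (P i))"

text \<open>For a left ideal \<open>I\<close>, the submodule \<open>IM\<close> consisting of the sums of elements \<open>a m\<close>.\<close>

inductive_set ideal_smult :: "'a set \<Rightarrow> ('a, 'm) module \<Rightarrow> 'm set" for I and M where
  smult: "\<lbrakk>a \<in> I; x \<in> carrier M\<rbrakk> \<Longrightarrow> a \<odot>\<^bsub>M\<^esub> x \<in> ideal_smult I M"
| sum: "\<lbrakk>u \<in> ideal_smult I M; v \<in> ideal_smult I M\<rbrakk> \<Longrightarrow> u \<oplus>\<^bsub>M\<^esub> v \<in> ideal_smult I M"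

definition minimal_complex ::
    "('a, 'r) ring_scheme \<Rightarrow> (int \<Rightarrow> ('a, 'm) module) \<Rightarrow> (int \<Rightarrow> 'm \<Rightarrow> 'm) \<Rightarrow> bool" where
  "minimal_complex R P d \<longleftrightarrow>
    (\<forall>i. d i ` carrier (P i) \<subseteq> ideal_smult (radical R) (P (i - 1)))"

definition type_I_complex ::
    "('a, 'r) ring_scheme \<Rightarrow> (int \<Rightarrow> ('a, 'm) module) \<Rightarrow> (int \<Rightarrow> 'm \<Rightarrow> 'm) \<Rightarrow> bool" where
  "type_I_complex R P d \<longleftrightarrow>
    exact_projective_complex R P d \<and> minimal_complex R P d \<and>
    (\<exists>i. carrier (P i) \<noteq> {\<zero>\<^bsub>P i\<^esub>}) \<and>
    (\<exists>n. \<forall>i. has_rank R (P i) n)"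

text \<open>Right modules are left modules over the opposite ring. The right module
  \<open>Hom\<^sub>A(M, A)\<close> is realised on extensional functions, so that equality of homomorphisms is
  equality in HOL.\<close>

definition opposite_ring :: "('a, 'r) ring_scheme \<Rightarrow> 'a ring" where
  "opposite_ring A =
    \<lparr>carrier = carrier A, mult = (\<lambda>a b. b \<otimes>\<^bsub>A\<^esub> a), one = one A, zero = zero A, add = add A\<rparr>"

definition dual_module :: "('a, 'r) ring_scheme \<Rightarrow> ('a, 'm) module \<Rightarrow> ('a, 'm \<Rightarrow> 'a) module" where
  "dual_module A M =
    \<lparr>carrier = lmod_hom A M (left_regular A) \<inter> extensional (carrier M),
     mult = undefined, one = undefined,
     zero = (\<lambda>m\<in>carrier M. \<zero>\<^bsub>A\<^esub>),
     add = (\<lambda>f g. \<lambda>m\<in>carrier M. f m \<oplus>\<^bsub>A\<^esub> g m),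
     smult = (\<lambda>a f. \<lambda>m\<in>carrier M. f m \<otimes>\<^bsub>A\<^esub> a)\<rparr>"

text \<open>Dualising reverses the arrows, so degree \<open>i\<close> of the dual complex is \<open>Hom\<^sub>A(P (-i), A)\<close>, and its
  differential is precomposition with \<open>d (1 - i)\<close>, which maps \<open>P (-(i - 1))\<close> to \<open>P (-i)\<close>.\<close>

definition dual_modules ::
    "('a, 'r) ring_scheme \<Rightarrow> (int \<Rightarrow> ('a, 'm) module) \<Rightarrow> int \<Rightarrow> ('a, 'm \<Rightarrow> 'a) module" where
  "dual_modules A P i = dual_module A (P (- i))"

definition dual_maps ::
    "(int \<Rightarrow> ('a, 'm) module) \<Rightarrow> (int \<Rightarrow> 'm \<Rightarrow> 'm) \<Rightarrow> int \<Rightarrow> ('m \<Rightarrow> 'a) \<Rightarrow> ('m \<Rightarrow> 'a)" where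
  "dual_maps P d i f = compose (carrier (P (1 - i))) f (d (1 - i))"

definition dual_exact ::
    "('a, 'r) ring_scheme \<Rightarrow> (int \<Rightarrow> ('a, 'm) module) \<Rightarrow> (int \<Rightarrow> 'm \<Rightarrow> 'm) \<Rightarrow> bool" where
  "dual_exact A P d \<longleftrightarrow>
    exact_complex (opposite_ring A) (dual_modules A P) (dual_maps P d)"

text \<open>The witnessing complex is taken on the type \<open>nat \<Rightarrow> 'a\<close>. This is no restriction up to
  isomorphism: every finitely generated left module over a ring on the type \<open>'a\<close> has an isomorphic
  copy whose carrier is a subset of \<open>nat \<Rightarrow> 'a\<close>.\<close>

definition gorenstein_projective :: "('a, 'r) ring_scheme \<Rightarrow> ('a, 'm) module \<Rightarrow> bool" where
  "gorenstein_projective A M \<longleftrightarrow> left_module A M \<and>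
    (\<exists>(P :: int \<Rightarrow> ('a, nat \<Rightarrow> 'a) module) d i.
      exact_projective_complex A P d \<and> dual_exact A P d \<and>
      lmod_isomorphic A M ((P (i - 1))\<lparr>carrier := d i ` carrier (P i)\<rparr>))"

end

theory Submission
  imports Defs
begin

text \<open>Write \<open>J\<close> for the radical. If \<open>x\<close> is a left Conca element, then \<open>x \<in> J\<close>, since \<open>x\<close> is nilpotent,
  and \<open>x \<notin> J\<^sup>2\<close>, since otherwise \<open>J\<^sup>2 = J x \<subseteq> J\<^sup>3 = 0\<close> although \<open>J\<^sup>2\<close> has length \<open>e - 1 \<ge> 1\<close>. The complex
  is exact if and only if \<open>A x\<close> is the whole kernel of the right multiplication \<open>r(x)\<close>. This kernel
  lies in \<open>J\<close>, because elements outside \<open>J\<close> are not zero divisors, and it contains \<open>J\<^sup>2\<close>. Thus it is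
  the preimage of the kernel of the surjection \<open>J/J\<^sup>2 \<rightarrow> J x = J\<^sup>2\<close> induced by \<open>r(x)\<close>. The Hilbert type
  \<open>(e, e - 1)\<close> says that the latter kernel has length one, so it is generated by the class of \<open>x\<close>, and
  the kernel of \<open>r(x)\<close> is \<open>k x + J\<^sup>2 = k x + J x = A x\<close>.

  Length is defined by chains of submodules, and the length count is carried out on chains: if the
  kernel in \<open>J\<close> were larger than \<open>k x + J\<^sup>2\<close>, then a chain of length \<open>e - 1\<close> in \<open>J\<^sup>2\<close>, pulled back to
  \<open>J\<close>, could be extended below by \<open>J\<^sup>2 \<subset> k x + J\<^sup>2\<close> to a chain of length \<open>e + 1\<close> between \<open>J\<^sup>2\<close> and
  \<open>J\<close>. This is \<open>radical_map_kernel\<close>. Since \<open>J\<close> annihilates \<open>J/J\<^sup>2\<close> and \<open>J\<^sup>2\<close> on both sides, and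
  \<open>A = k + J\<close> with central \<open>k\<close>, the submodules that occur are just the subspaces over \<open>k\<close>. Therefore
  the argument applies to any linear map, and for a Conca element also to the left multiplication by
  \<open>x\<close>; hence the left multiplication has kernel \<open>x A\<close>.

  The remaining part is formal. A homomorphism from a free module of rank one to \<open>A\<close> is determined by
  its value at the basis element, so dualising turns \<open>r(x)\<close> into the left multiplication by \<open>x\<close>
  on the right module \<open>A\<close>, and exactness of the dual complex is the statement on the kernel of that
  map. The locale \<open>rank_one_complex\<close> provides this for every module isomorphic to \<open>A\<close>.\<close>

section \<open>Left modules and their submodules\<close>

lemma (in left_module) submoduleI:
  assumes "H \<subseteq> carrier M" and "\<zero>\<^bsub>M\<^esub> \<in> H"
    and "\<And>u v. \<lbrakk>u \<in> H; v \<in> H\<rbrakk> \<Longrightarrow> u \<oplus>\<^bsub>M\<^esub> v \<in> H"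
    and smul: "\<And>a u. \<lbrakk>a \<in> carrier R; u \<in> H\<rbrakk> \<Longrightarrow> a \<odot>\<^bsub>M\<^esub> u \<in> H"
  shows "submodule H R M"
proof -
  have zero: "\<zero> \<odot>\<^bsub>M\<^esub> u = \<zero>\<^bsub>M\<^esub>" if "u \<in> carrier M" for u
    using smult_l_distr[of \<zero> \<zero> u] that
    by (simp add: M.add.r_cancel_one')
  have "\<ominus>\<^bsub>M\<^esub> u \<in> H" if "u \<in> H" for u
  proof -
    have u: "u \<in> carrier M"
      using that assms(1) by blast
    have "(\<ominus> \<one>) \<odot>\<^bsub>M\<^esub> u \<oplus>\<^bsub>M\<^esub> u = \<zero>\<^bsub>M\<^esub>"
      using smult_l_distr[of "\<ominus> \<one>" \<one> u] u zero by (simp add: R.l_neg)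
    then have "\<ominus>\<^bsub>M\<^esub> u = (\<ominus> \<one>) \<odot>\<^bsub>M\<^esub> u"
      using u M.minus_equality by simp
    then show ?thesis
      using smul that by simp
  qed
  then show ?thesis
    using assms by (intro submodule.intro subgroup.intro submodule_axioms.intro)
      (auto simp: a_inv_def)
qed

lemma submoduleD:
  assumes "submodule H R M"
  shows "H \<subseteq> carrier M" and "\<zero>\<^bsub>M\<^esub> \<in> H"
    and "\<And>u v. \<lbrakk>u \<in> H; v \<in> H\<rbrakk> \<Longrightarrow> u \<oplus>\<^bsub>M\<^esub> v \<in> H"
    and "\<And>a u. \<lbrakk>a \<in> carrier R; u \<in> H\<rbrakk> \<Longrightarrow> a \<odot>\<^bsub>M\<^esub> u \<in> H"
  using submodule.axioms(1)[OF assms, THEN subgroup.subset]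
    submodule.axioms(1)[OF assms, THEN subgroup.one_closed]
    submodule.axioms(1)[OF assms, THEN subgroup.m_closed]
    submodule.smult_closed[OF assms]
  by auto

lemma (in left_module) submodule_left_module:
  assumes "submodule N R M"
  shows "left_module R (M\<lparr>carrier := N\<rparr>)"
proof -
  note N = submoduleD[OF assms]
  have inv: "\<ominus>\<^bsub>M\<^esub> u \<in> N" if "u \<in> N" for u
    using subgroup.m_inv_closed[OF submodule.axioms(1)[OF assms] that] by (simp add: a_inv_def)
  have "abelian_group (M\<lparr>carrier := N\<rparr>)"
    apply (rule abelian_groupI)
    using N inv M.a_assoc M.a_comm M.l_neg apply (auto simp: subset_iff)
    by metis
  then show ?thesis
    using N smult_l_distr smult_r_distr smult_assoc
    by (intro left_module.intro left_module_axioms.intro) (auto simp: subset_iff R.ring_axioms)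
qed

lemma left_regular_left_module:
  assumes "ring A"
  shows "left_module A (left_regular A)"
proof -
  interpret ring A by fact
  have "abelian_group (left_regular A)"
    apply (rule abelian_groupI)
    using a_assoc a_comm l_neg a_inv_closed by (auto simp: left_regular_def) 
  then show ?thesis
    by (intro left_module.intro left_module_axioms.intro)
      (auto simp: left_regular_def ring_axioms l_distr r_distr m_assoc)
qed

lemma free_module_left_module:
  assumes "ring A"
  shows "left_module A (free_module A n)"
proof -
  interpret ring A by fact
  have carr: "f i \<in> carrier A" if "f \<in> carrier (free_module A n)" for f i
    using that by (cases "i < n") (auto simp: free_module_def)
  have ops: "f \<oplus>\<^bsub>free_module A n\<^esub> g = (\<lambda>i. f i \<oplus>\<^bsub>A\<^esub> g i)"
      "a \<odot>\<^bsub>free_module A n\<^esub> f = (\<lambda>i. a \<otimes>\<^bsub>A\<^esub> f i)"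
      "\<zero>\<^bsub>free_module A n\<^esub> = (\<lambda>_. \<zero>\<^bsub>A\<^esub>)" for a f g
    by (simp_all add: free_module_def)
  have closed: "(\<lambda>_. \<zero>\<^bsub>A\<^esub>) \<in> carrier (free_module A n)"
    "\<lbrakk>f \<in> carrier (free_module A n); g \<in> carrier (free_module A n)\<rbrakk>
      \<Longrightarrow> (\<lambda>i. f i \<oplus>\<^bsub>A\<^esub> g i) \<in> carrier (free_module A n)"
    "\<lbrakk>a \<in> carrier A; f \<in> carrier (free_module A n)\<rbrakk>
      \<Longrightarrow> (\<lambda>i. a \<otimes>\<^bsub>A\<^esub> f i) \<in> carrier (free_module A n)"
    "f \<in> carrier (free_module A n) \<Longrightarrow> (\<lambda>i. \<ominus>\<^bsub>A\<^esub> f i) \<in> carrier (free_module A n)" for a f g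
    by (simp_all add: free_module_def)
  have "abelian_group (free_module A n)"
  proof (rule abelian_groupI, unfold ops)
    fix f assume f: "f \<in> carrier (free_module A n)"
    show "\<exists>g\<in>carrier (free_module A n). (\<lambda>i. g i \<oplus>\<^bsub>A\<^esub> f i) = (\<lambda>_. \<zero>\<^bsub>A\<^esub>)"
      using f by (intro bexI[of _ "\<lambda>i. \<ominus>\<^bsub>A\<^esub> f i"]) (simp_all add: carr closed l_neg)
  qed (simp_all add: closed carr a_assoc, simp add: carr a_comm)
  then show ?thesis
    by (intro left_module.intro left_module_axioms.intro ring_axioms)
      (simp_all add: ops closed carr l_distr r_distr m_assoc)
qed

lemma lmod_homD:
  assumes "h \<in> lmod_hom R M N"
  shows "\<And>u. u \<in> carrier M \<Longrightarrow> h u \<in> carrier N"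
    and "\<And>u v. \<lbrakk>u \<in> carrier M; v \<in> carrier M\<rbrakk> \<Longrightarrow> h (u \<oplus>\<^bsub>M\<^esub> v) = h u \<oplus>\<^bsub>N\<^esub> h v"
    and "\<And>a u. \<lbrakk>a \<in> carrier R; u \<in> carrier M\<rbrakk> \<Longrightarrow> h (a \<odot>\<^bsub>M\<^esub> u) = a \<odot>\<^bsub>N\<^esub> h u"
  using assms by (auto simp: lmod_hom_def)

lemma lmod_hom_inv:
  assumes M: "left_module R M" and h: "h \<in> lmod_hom R M N"
    and bij: "bij_betw h (carrier M) (carrier N)"
  shows "inv_into (carrier M) h \<in> lmod_hom R N M"
proof -
  interpret left_module R M by fact
  let ?g = "inv_into (carrier M) h"
  have g: "?g v \<in> carrier M" "h (?g v) = v" if "v \<in> carrier N" for v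
    using bij_betw_inv_into[OF bij] bij_betw_inv_into_right[OF bij that] that
    by (auto simp: bij_betw_def)
  have gh: "?g (h u) = u" if "u \<in> carrier M" for u
    using bij_betw_inv_into_left[OF bij that] .
  have "?g (u \<oplus>\<^bsub>N\<^esub> v) = ?g u \<oplus>\<^bsub>M\<^esub> ?g v" if "u \<in> carrier N" "v \<in> carrier N" for u v
    using gh[of "?g u \<oplus>\<^bsub>M\<^esub> ?g v"] lmod_homD(2)[OF h, of "?g u" "?g v"] g that by simp
  moreover have "?g (a \<odot>\<^bsub>N\<^esub> v) = a \<odot>\<^bsub>M\<^esub> ?g v" if "a \<in> carrier R" "v \<in> carrier N" for a v
    using gh[of "a \<odot>\<^bsub>M\<^esub> ?g v"] lmod_homD(3)[OF h, of a "?g v"] g that by simp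
  ultimately show ?thesis
    using g by (auto simp: lmod_hom_def)
qed

lemma has_rank_projective:
  assumes "left_module R M" and "has_rank R M n"
  shows "projective_module R M"
proof -
  obtain h where h: "h \<in> lmod_hom R M (free_module R n)"
      "bij_betw h (carrier M) (carrier (free_module R n))"
    using assms(2) by (auto simp: has_rank_def lmod_isomorphic_def)
  then show ?thesis
    using assms(1) lmod_hom_inv[OF assms(1) h] bij_betw_inv_into_left[OF h(2)]
    unfolding projective_module_def by blast
qed

section \<open>Free modules of rank one\<close>

definition first_coordinate :: "('a, 'r) ring_scheme \<Rightarrow> 'a \<Rightarrow> nat \<Rightarrow> 'a" where
  "first_coordinate A a = (\<lambda>n. if n = 0 then a else \<zero>\<^bsub>A\<^esub>)"

lemma first_coordinate_hom:
  assumes "ring A"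
  shows "first_coordinate A \<in> lmod_hom A (left_regular A) (free_module A 1)"
proof -
  interpret ring A by fact
  show ?thesis
    by (auto simp: first_coordinate_def lmod_hom_def left_regular_def free_module_def)
qed

lemma free_module_one_eq:
  assumes "f \<in> carrier (free_module A 1)"
  shows "first_coordinate A (f 0) = f"
  using assms by (auto simp: first_coordinate_def free_module_def)

lemma left_regular_has_rank:
  assumes "ring A"
  shows "has_rank A (left_regular A) 1"
proof -
  have "bij_betw (first_coordinate A) (carrier (left_regular A)) (carrier (free_module A 1))"
    by (rule bij_betw_byWitness[where f' = "\<lambda>f. f 0"])
      (auto simp: first_coordinate_def free_module_def left_regular_def)
  then show ?thesis
    using first_coordinate_hom[OF assms] by (auto simp: has_rank_def lmod_isomorphic_def)
qed

lemma free_module_one_coordinate: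
  assumes "ring A"
  shows "(\<lambda>f. f 0) \<in> lmod_hom A (free_module A 1) (left_regular A)"
    and "bij_betw (\<lambda>f. f 0) (carrier (free_module A 1)) (carrier (left_regular A))"
proof -
  show "(\<lambda>f. f 0) \<in> lmod_hom A (free_module A 1) (left_regular A)"
    by (auto simp: lmod_hom_def left_regular_def free_module_def)
  show "bij_betw (\<lambda>f. f 0) (carrier (free_module A 1)) (carrier (left_regular A))"
    by (rule bij_betw_byWitness[where f' = "first_coordinate A"])
      (auto simp: first_coordinate_def free_module_def left_regular_def)
qed

section \<open>Duals of left modules\<close>

lemma dual_left_module:
  fixes A :: "('a, 'r) ring_scheme" (structure) and M :: "('a, 'm) module"
  assumes "left_module A M"
  shows "left_module (opposite_ring A) (dual_module A M)"
proof -
  interpret left_module A M by fact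
  let ?D = "dual_module A M"
  have opp: "ring (opposite_ring A)"
  proof (rule ringI)
    show "abelian_group (opposite_ring A)"
      apply (rule abelian_groupI)
      using R.a_assoc R.a_comm R.l_neg R.a_inv_closed by (auto simp: opposite_ring_def)
    show "monoid (opposite_ring A)"
      by (rule monoidI) (auto simp: opposite_ring_def R.m_assoc)
  qed (auto simp: opposite_ring_def R.l_distr R.r_distr)
  have eqI: "f = g" if "f \<in> extensional (carrier M)" "g \<in> extensional (carrier M)"
    "\<And>m. m \<in> carrier M \<Longrightarrow> f m = g m" for f g :: "'m \<Rightarrow> 'a"
    using extensionalityI[of f "carrier M" g] that by blast
  have hom: "\<And>m. m \<in> carrier M \<Longrightarrow> f m \<in> carrier A"
      "\<And>m m'. \<lbrakk>m \<in> carrier M; m' \<in> carrier M\<rbrakk> \<Longrightarrow> f (m \<oplus>\<^bsub>M\<^esub> m') = f m \<oplus> f m'"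
      "\<And>b m. \<lbrakk>b \<in> carrier A; m \<in> carrier M\<rbrakk> \<Longrightarrow> f (b \<odot>\<^bsub>M\<^esub> m) = b \<otimes> f m"
    if "f \<in> carrier ?D" for f
    using that by (auto simp: dual_module_def lmod_hom_def left_regular_def)
  have carrI: "f \<in> carrier ?D" if "f \<in> extensional (carrier M)"
      "\<And>m. m \<in> carrier M \<Longrightarrow> f m \<in> carrier A"
      "\<And>m m'. \<lbrakk>m \<in> carrier M; m' \<in> carrier M\<rbrakk> \<Longrightarrow> f (m \<oplus>\<^bsub>M\<^esub> m') = f m \<oplus> f m'"
      "\<And>b m. \<lbrakk>b \<in> carrier A; m \<in> carrier M\<rbrakk> \<Longrightarrow> f (b \<odot>\<^bsub>M\<^esub> m) = b \<otimes> f m" for f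
    using that by (auto simp: dual_module_def lmod_hom_def left_regular_def)
  have add: "f \<oplus>\<^bsub>?D\<^esub> g = (\<lambda>m\<in>carrier M. f m \<oplus> g m)" for f g
    by (simp add: dual_module_def)
  have smult: "a \<odot>\<^bsub>?D\<^esub> f = (\<lambda>m\<in>carrier M. f m \<otimes> a)" for a f
    by (simp add: dual_module_def)
  have zero: "\<zero>\<^bsub>?D\<^esub> = (\<lambda>m\<in>carrier M. \<zero>)"
    by (simp add: dual_module_def)
  have ext: "f \<in> extensional (carrier M)" if "f \<in> carrier ?D" for f
    using that by (simp add: dual_module_def)
  have addc: "f \<oplus>\<^bsub>?D\<^esub> g \<in> carrier ?D" if "f \<in> carrier ?D" "g \<in> carrier ?D" for f g
    unfolding add using hom[OF that(1)] hom[OF that(2)]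
    by (intro carrI) (auto simp: R.r_distr R.add.m_ac)
  have smultc: "a \<odot>\<^bsub>?D\<^esub> f \<in> carrier ?D" if "f \<in> carrier ?D" "a \<in> carrier A" for f a
    unfolding smult using hom[OF that(1)] that(2)
    by (intro carrI) (auto simp: R.l_distr R.m_assoc)
  have ab: "abelian_group ?D"
  proof (rule abelian_groupI)
    show "\<zero>\<^bsub>?D\<^esub> \<in> carrier ?D"
      unfolding zero by (intro carrI) auto
  next
    fix f assume f: "f \<in> carrier ?D"
    have "(\<ominus> \<one>) \<odot>\<^bsub>?D\<^esub> f \<oplus>\<^bsub>?D\<^esub> f = \<zero>\<^bsub>?D\<^esub>"
      unfolding smult add zero
      by (rule eqI) (use f hom in \<open>auto simp: R.r_minus R.l_neg\<close>)
    then show "\<exists>g\<in>carrier ?D. g \<oplus>\<^bsub>?D\<^esub> f = \<zero>\<^bsub>?D\<^esub>"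
      using smultc[OF f, of "\<ominus> \<one>"] by blast
    show "\<zero>\<^bsub>?D\<^esub> \<oplus>\<^bsub>?D\<^esub> f = f"
      unfolding add zero by (rule eqI) (use f hom ext in auto)
  next
    fix f g assume "f \<in> carrier ?D" "g \<in> carrier ?D"
    then show "f \<oplus>\<^bsub>?D\<^esub> g = g \<oplus>\<^bsub>?D\<^esub> f"
      unfolding add by (intro eqI) (use hom in \<open>auto simp: R.add.m_ac\<close>)
  next
    fix f g h assume "f \<in> carrier ?D" "g \<in> carrier ?D" "h \<in> carrier ?D"
    then show "f \<oplus>\<^bsub>?D\<^esub> g \<oplus>\<^bsub>?D\<^esub> h = f \<oplus>\<^bsub>?D\<^esub> (g \<oplus>\<^bsub>?D\<^esub> h)"
      unfolding add by (intro eqI) (use hom in \<open>auto simp: R.add.m_ac\<close>)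
  qed (rule addc)
  have opp_simps: "carrier (opposite_ring A) = carrier A" "one (opposite_ring A) = \<one>"
      "a \<oplus>\<^bsub>opposite_ring A\<^esub> b = a \<oplus> b" "a \<otimes>\<^bsub>opposite_ring A\<^esub> b = b \<otimes> a" for a b
    by (auto simp: opposite_ring_def)
  show ?thesis
  proof (intro left_module.intro left_module_axioms.intro opp ab, unfold opp_simps)
    fix a b f assume "a \<in> carrier A" "b \<in> carrier A" "f \<in> carrier ?D"
    then show "(a \<oplus> b) \<odot>\<^bsub>?D\<^esub> f = a \<odot>\<^bsub>?D\<^esub> f \<oplus>\<^bsub>?D\<^esub> b \<odot>\<^bsub>?D\<^esub> f"
      and "(b \<otimes> a) \<odot>\<^bsub>?D\<^esub> f = a \<odot>\<^bsub>?D\<^esub> (b \<odot>\<^bsub>?D\<^esub> f)"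
      unfolding add smult by (auto intro!: eqI simp: hom R.r_distr R.m_assoc)
  next
    fix a f g assume "a \<in> carrier A" "f \<in> carrier ?D" "g \<in> carrier ?D"
    then show "a \<odot>\<^bsub>?D\<^esub> (f \<oplus>\<^bsub>?D\<^esub> g) = a \<odot>\<^bsub>?D\<^esub> f \<oplus>\<^bsub>?D\<^esub> a \<odot>\<^bsub>?D\<^esub> g"
      unfolding add smult by (intro eqI) (auto simp: hom R.l_distr)
  next
    fix f assume "f \<in> carrier ?D"
    then show "\<one> \<odot>\<^bsub>?D\<^esub> f = f"
      unfolding smult by (intro eqI) (auto simp: hom ext)
  qed (rule smultc)
qed

section \<open>The complex given by right multiplication\<close>

text \<open>The map \<open>\<pi>\<close> is a coordinate on a free module \<open>M\<close> of rank one, and in this coordinate the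
  differential \<open>d\<close> is the right multiplication by \<open>x\<close>. The isomorphism is kept explicit because the
  complex is used both on \<open>A\<close> itself and on the sequences \<open>A\<^sup>1\<close>.\<close>

locale rank_one_complex = left_module A M
  for A :: "('a, 'r) ring_scheme" and M :: "('a, 'm) module" +
  fixes \<pi> :: "'m \<Rightarrow> 'a" and d :: "'m \<Rightarrow> 'm" and x :: 'a
  assumes coord_hom: "\<pi> \<in> lmod_hom A M (left_regular A)"
    and coord_bij: "bij_betw \<pi> (carrier M) (carrier (left_regular A))"
    and x_closed: "x \<in> carrier A"
    and d_closed: "\<And>m. m \<in> carrier M \<Longrightarrow> d m \<in> carrier M"
    and coord_d: "\<And>m. m \<in> carrier M \<Longrightarrow> \<pi> (d m) = \<pi> m \<otimes>\<^bsub>A\<^esub> x"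
begin

lemma coord:
  shows "\<And>u. u \<in> carrier M \<Longrightarrow> \<pi> u \<in> carrier A"
    and "\<And>u v. \<lbrakk>u \<in> carrier M; v \<in> carrier M\<rbrakk> \<Longrightarrow> \<pi> (u \<oplus>\<^bsub>M\<^esub> v) = \<pi> u \<oplus>\<^bsub>A\<^esub> \<pi> v"
    and "\<And>a u. \<lbrakk>a \<in> carrier A; u \<in> carrier M\<rbrakk> \<Longrightarrow> \<pi> (a \<odot>\<^bsub>M\<^esub> u) = a \<otimes>\<^bsub>A\<^esub> \<pi> u"
  using lmod_homD[OF coord_hom] by (auto simp: left_regular_def)

lemma coord_inj: "\<lbrakk>u \<in> carrier M; v \<in> carrier M; \<pi> u = \<pi> v\<rbrakk> \<Longrightarrow> u = v"
  using coord_bij by (auto simp: bij_betw_def inj_on_def)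

lemma coord_surj: "a \<in> carrier A \<Longrightarrow> \<exists>u\<in>carrier M. \<pi> u = a"
  using bij_betw_imp_surj_on[OF coord_bij] by (simp add: left_regular_def) (metis imageE)

lemma coord_zero: "\<pi> \<zero>\<^bsub>M\<^esub> = \<zero>\<^bsub>A\<^esub>"
proof -
  have "\<pi> \<zero>\<^bsub>M\<^esub> \<oplus>\<^bsub>A\<^esub> \<pi> \<zero>\<^bsub>M\<^esub> = \<pi> \<zero>\<^bsub>M\<^esub>"
    using coord(2)[of "\<zero>\<^bsub>M\<^esub>" "\<zero>\<^bsub>M\<^esub>"] by simp
  then show ?thesis
    using coord(1)[of "\<zero>\<^bsub>M\<^esub>"] by (simp add: R.add.r_cancel_one)
qed

lemma d_hom: "d \<in> lmod_hom A M M"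
proof -
  have "d (u \<oplus>\<^bsub>M\<^esub> v) = d u \<oplus>\<^bsub>M\<^esub> d v" if "u \<in> carrier M" "v \<in> carrier M" for u v
    using that by (intro coord_inj) (auto simp: coord d_closed coord_d x_closed R.l_distr)
  moreover have "d (a \<odot>\<^bsub>M\<^esub> u) = a \<odot>\<^bsub>M\<^esub> d u" if "a \<in> carrier A" "u \<in> carrier M" for a u
    using that by (intro coord_inj) (auto simp: coord d_closed coord_d x_closed R.m_assoc)
  ultimately show ?thesis
    by (auto simp: lmod_hom_def d_closed)
qed

lemma exact:
  assumes ker: "{a \<in> carrier A. a \<otimes>\<^bsub>A\<^esub> x = \<zero>\<^bsub>A\<^esub>} = carrier A #>\<^bsub>A\<^esub> x"
  shows "exact_complex A (\<lambda>_. M) (\<lambda>_. d)"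
proof -
  have "d ` carrier M = a_kernel M M d"
  proof (intro equalityI subsetI)
    fix u assume "u \<in> d ` carrier M"
    then obtain v where v: "v \<in> carrier M" "u = d v" by blast
    have "\<pi> u \<in> carrier A #>\<^bsub>A\<^esub> x"
      using v coord by (auto simp: coord_d r_coset_def)
    then have "\<pi> (d u) = \<pi> \<zero>\<^bsub>M\<^esub>"
      using ker v by (auto simp: coord_d coord_zero d_closed)
    then have "d u = \<zero>\<^bsub>M\<^esub>"
      using v by (intro coord_inj) (auto simp: d_closed)
    then show "u \<in> a_kernel M M d"
      using v by (simp add: a_kernel_def' d_closed)
  next
    fix u assume "u \<in> a_kernel M M d"
    then have u: "u \<in> carrier M" "d u = \<zero>\<^bsub>M\<^esub>"
      by (auto simp: a_kernel_def')
    then have "\<pi> u \<otimes>\<^bsub>A\<^esub> x = \<zero>\<^bsub>A\<^esub>"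
      using coord_d coord_zero by metis
    then have "\<pi> u \<in> carrier A #>\<^bsub>A\<^esub> x"
      using ker u coord by blast
    then obtain a where a: "a \<in> carrier A" "\<pi> u = a \<otimes>\<^bsub>A\<^esub> x"
      by (auto simp: r_coset_def)
    obtain v where v: "v \<in> carrier M" "\<pi> v = a"
      using coord_surj a by blast
    have "u = d v"
      using u v a by (intro coord_inj) (auto simp: d_closed coord_d)
    then show "u \<in> d ` carrier M"
      using v by blast
  qed
  then show ?thesis
    using left_module_axioms d_hom by (simp add: exact_complex_def)
qed

text \<open>A homomorphism \<open>f: M \<rightarrow> A\<close> is determined by its value at the basis element \<open>g\<close>, and
  \<open>f (d g) = f (x g) = x f g\<close>. So under \<open>f \<mapsto> f g\<close> the dual differential becomes the left multiplication
  by \<open>x\<close>.\<close>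

lemma dual_exact:
  assumes ker: "{a \<in> carrier A. x \<otimes>\<^bsub>A\<^esub> a = \<zero>\<^bsub>A\<^esub>} = x <#\<^bsub>A\<^esub> carrier A"
  shows "dual_exact A (\<lambda>_. M) (\<lambda>_. d)"
proof -
  let ?D = "dual_module A M" and ?\<delta> = "\<lambda>f. compose (carrier M) f d"
  obtain g where g: "g \<in> carrier M" "\<pi> g = \<one>\<^bsub>A\<^esub>"
    using coord_surj by blast
  have D: "\<And>m. m \<in> carrier M \<Longrightarrow> f m \<in> carrier A"
      "\<And>m m'. \<lbrakk>m \<in> carrier M; m' \<in> carrier M\<rbrakk> \<Longrightarrow> f (m \<oplus>\<^bsub>M\<^esub> m') = f m \<oplus>\<^bsub>A\<^esub> f m'"
      "\<And>b m. \<lbrakk>b \<in> carrier A; m \<in> carrier M\<rbrakk> \<Longrightarrow> f (b \<odot>\<^bsub>M\<^esub> m) = b \<otimes>\<^bsub>A\<^esub> f m"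
    if "f \<in> carrier ?D" for f
    using that by (auto simp: dual_module_def lmod_hom_def left_regular_def)
  have basis: "m = \<pi> m \<odot>\<^bsub>M\<^esub> g" if "m \<in> carrier M" for m
    using that g by (intro coord_inj) (auto simp: coord)
  have dg: "d m = (\<pi> m \<otimes>\<^bsub>A\<^esub> x) \<odot>\<^bsub>M\<^esub> g" if "m \<in> carrier M" for m
    using basis[OF d_closed[OF that]] coord_d[OF that] by simp
  have val: "f m = \<pi> m \<otimes>\<^bsub>A\<^esub> f g" if "f \<in> carrier ?D" "m \<in> carrier M" for f m
    using D(3)[OF that(1) coord(1)[OF that(2)] g(1)] basis[OF that(2)] by simp
  have vald: "f (d m) = \<pi> m \<otimes>\<^bsub>A\<^esub> (x \<otimes>\<^bsub>A\<^esub> f g)" if "f \<in> carrier ?D" "m \<in> carrier M" for f m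
    using val[OF that(1) d_closed[OF that(2)]] that D(1)[OF that(1) g(1)]
    by (simp add: coord_d coord x_closed R.m_assoc)
  have closed: "?\<delta> f \<in> carrier ?D" if f: "f \<in> carrier ?D" for f
    using D[OF f] lmod_homD[OF d_hom]
    by (auto simp: dual_module_def lmod_hom_def left_regular_def compose_def)
  have hom: "?\<delta> \<in> lmod_hom (opposite_ring A) ?D ?D"
  proof -
    have "?\<delta> (f \<oplus>\<^bsub>?D\<^esub> h) = ?\<delta> f \<oplus>\<^bsub>?D\<^esub> ?\<delta> h" for f h
      by (auto simp: dual_module_def compose_def d_closed)
    moreover have "?\<delta> (a \<odot>\<^bsub>?D\<^esub> f) = a \<odot>\<^bsub>?D\<^esub> ?\<delta> f" for a f
      by (auto simp: dual_module_def compose_def d_closed)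
    ultimately show ?thesis
      using closed by (auto simp: lmod_hom_def)
  qed
  have "?\<delta> ` carrier ?D = a_kernel ?D ?D ?\<delta>"
  proof (intro equalityI subsetI)
    fix f assume "f \<in> ?\<delta> ` carrier ?D"
    then obtain h where h: "h \<in> carrier ?D" "f = ?\<delta> h" by blast
    have hg: "h g \<in> carrier A"
      using D(1)[OF h(1) g(1)] .
    then have "x \<otimes>\<^bsub>A\<^esub> h g \<in> x <#\<^bsub>A\<^esub> carrier A"
      by (auto simp: l_coset_def)
    then have xx: "x \<otimes>\<^bsub>A\<^esub> (x \<otimes>\<^bsub>A\<^esub> h g) = \<zero>\<^bsub>A\<^esub>"
      using ker by blast
    have "f g = x \<otimes>\<^bsub>A\<^esub> h g"
      using vald[OF h(1) g(1)] h g hg by (simp add: compose_def x_closed)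
    then have "f (d m) = \<zero>\<^bsub>A\<^esub>" if "m \<in> carrier M" for m
      using vald[OF closed[OF h(1)] that] h xx that coord by simp
    then have "?\<delta> f = \<zero>\<^bsub>?D\<^esub>"
      by (auto simp: dual_module_def compose_def)
    then show "f \<in> a_kernel ?D ?D ?\<delta>"
      using h closed by (simp add: a_kernel_def')
  next
    fix f assume "f \<in> a_kernel ?D ?D ?\<delta>"
    then have f: "f \<in> carrier ?D" "?\<delta> f = \<zero>\<^bsub>?D\<^esub>"
      by (auto simp: a_kernel_def')
    have fg: "f g \<in> carrier A"
      using D(1)[OF f(1) g(1)] .
    have "f (d g) = \<zero>\<^bsub>A\<^esub>"
      using fun_cong[OF f(2), of g] g by (simp add: compose_def dual_module_def)
    then have "x \<otimes>\<^bsub>A\<^esub> f g = \<zero>\<^bsub>A\<^esub>"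
      using vald[OF f(1) g(1)] g fg by (simp add: x_closed)
    then have "f g \<in> x <#\<^bsub>A\<^esub> carrier A"
      using ker fg by blast
    then obtain b where b: "b \<in> carrier A" "f g = x \<otimes>\<^bsub>A\<^esub> b"
      by (auto simp: l_coset_def)
    \<comment> \<open>The homomorphism with value \<open>b\<close> at \<open>g\<close>, whose composite with \<open>d\<close> takes the value \<open>x b\<close> there.\<close>
    let ?h = "\<lambda>m\<in>carrier M. \<pi> m \<otimes>\<^bsub>A\<^esub> b"
    have h: "?h \<in> carrier ?D"
      using b coord by (auto simp: dual_module_def lmod_hom_def left_regular_def R.l_distr R.m_assoc)
    have "?\<delta> ?h = f"
    proof (rule extensionalityI[of _ "carrier M"])
      show "f \<in> extensional (carrier M)"
        using f by (simp add: dual_module_def)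
      show "?\<delta> ?h m = f m" if "m \<in> carrier M" for m
        using val[OF f(1) that] that b coord
        by (simp add: compose_def d_closed coord_d x_closed R.m_assoc)
    qed (simp add: compose_def)
    then show "f \<in> ?\<delta> ` carrier ?D"
      using h by blast
  qed
  then show ?thesis
    using dual_left_module[OF left_module_axioms] hom
    by (simp add: dual_exact_def exact_complex_def dual_modules_def[abs_def] dual_maps_def[abs_def])
qed

end

section \<open>Quotient modules and length\<close>

lemma (in left_module) quot_module_ops:
  assumes "submodule N R M"
  shows "carrier (quot_module M N) = (\<lambda>u. N +>\<^bsub>M\<^esub> u) ` carrier M"
    and "\<And>u v. \<lbrakk>u \<in> carrier M; v \<in> carrier M\<rbrakk> \<Longrightarrow>
      (N +>\<^bsub>M\<^esub> u) \<oplus>\<^bsub>quot_module M N\<^esub> (N +>\<^bsub>M\<^esub> v) = N +>\<^bsub>M\<^esub> (u \<oplus>\<^bsub>M\<^esub> v)"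
    and "\<And>a u. \<lbrakk>a \<in> carrier R; u \<in> carrier M\<rbrakk> \<Longrightarrow>
      a \<odot>\<^bsub>quot_module M N\<^esub> (N +>\<^bsub>M\<^esub> u) = N +>\<^bsub>M\<^esub> (a \<odot>\<^bsub>M\<^esub> u)"
    and "\<zero>\<^bsub>quot_module M N\<^esub> = N +>\<^bsub>M\<^esub> \<zero>\<^bsub>M\<^esub>"
proof -
  note N = submoduleD[OF assms]
  have N_carr: "w \<in> carrier M" if "w \<in> N" for w
    using N(1) that by auto
  interpret N: abelian_subgroup N M
    by (rule abelian_subgroupI3)
      (simp_all add: additive_subgroup.intro submodule.axioms(1)[OF assms] M.abelian_group_axioms)
  show "carrier (quot_module M N) = (\<lambda>u. N +>\<^bsub>M\<^esub> u) ` carrier M"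
    by (auto simp: quot_module_def A_RCOSETS_def' a_r_coset_def')
  show "(N +>\<^bsub>M\<^esub> u) \<oplus>\<^bsub>quot_module M N\<^esub> (N +>\<^bsub>M\<^esub> v) = N +>\<^bsub>M\<^esub> (u \<oplus>\<^bsub>M\<^esub> v)"
    if "u \<in> carrier M" "v \<in> carrier M" for u v
    using N.a_rcos_sum that by (simp add: quot_module_def)
  show "\<zero>\<^bsub>quot_module M N\<^esub> = N +>\<^bsub>M\<^esub> \<zero>\<^bsub>M\<^esub>"
    using N(1) M.a_coset_add_zero by (simp add: quot_module_def)
  show "a \<odot>\<^bsub>quot_module M N\<^esub> (N +>\<^bsub>M\<^esub> u) = N +>\<^bsub>M\<^esub> (a \<odot>\<^bsub>M\<^esub> u)"
    if a: "a \<in> carrier R" and u: "u \<in> carrier M" for a u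
  proof (intro equalityI subsetI)
    fix w assume "w \<in> a \<odot>\<^bsub>quot_module M N\<^esub> (N +>\<^bsub>M\<^esub> u)"
    then obtain n n' where n: "n \<in> N" "n' \<in> N" "w = n \<oplus>\<^bsub>M\<^esub> (a \<odot>\<^bsub>M\<^esub> (n' \<oplus>\<^bsub>M\<^esub> u))"
      by (auto simp: quot_module_def set_add_def' a_r_coset_def')
    have "w = (n \<oplus>\<^bsub>M\<^esub> a \<odot>\<^bsub>M\<^esub> n') \<oplus>\<^bsub>M\<^esub> a \<odot>\<^bsub>M\<^esub> u"
      using n a u by (simp add: N_carr smult_r_distr M.a_assoc)
    moreover have "n \<oplus>\<^bsub>M\<^esub> a \<odot>\<^bsub>M\<^esub> n' \<in> N"
      using n a N by simp
    ultimately show "w \<in> N +>\<^bsub>M\<^esub> (a \<odot>\<^bsub>M\<^esub> u)"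
      by (auto simp: a_r_coset_def')
  next
    fix w assume "w \<in> N +>\<^bsub>M\<^esub> (a \<odot>\<^bsub>M\<^esub> u)"
    then obtain n where n: "n \<in> N" "w = n \<oplus>\<^bsub>M\<^esub> a \<odot>\<^bsub>M\<^esub> u"
      by (auto simp: a_r_coset_def')
    then have "w = n \<oplus>\<^bsub>M\<^esub> a \<odot>\<^bsub>M\<^esub> (\<zero>\<^bsub>M\<^esub> \<oplus>\<^bsub>M\<^esub> u)" "\<zero>\<^bsub>M\<^esub> \<oplus>\<^bsub>M\<^esub> u \<in> N +>\<^bsub>M\<^esub> u"
      using u N(2) by (auto simp: a_r_coset_def')
    then show "w \<in> a \<odot>\<^bsub>quot_module M N\<^esub> (N +>\<^bsub>M\<^esub> u)"
      using n by (auto simp: quot_module_def set_add_def')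
  qed
qed

lemma (in left_module) quot_module_left_module:
  assumes N: "submodule N R M"
  shows "left_module R (quot_module M N)"
proof -
  note Q = quot_module_ops[OF N]
  let ?Q = "quot_module M N"
  have rep: thesis if "X \<in> carrier ?Q" "\<And>u. \<lbrakk>u \<in> carrier M; X = N +>\<^bsub>M\<^esub> u\<rbrakk> \<Longrightarrow> thesis" for X thesis
    using that(1) unfolding Q(1) by (elim imageE) (rule that(2))
  have coset: "N +>\<^bsub>M\<^esub> u \<in> carrier ?Q" if "u \<in> carrier M" for u
    unfolding Q(1) using that by (rule imageI)
  have "abelian_group ?Q"
  proof (rule abelian_groupI)
    show "\<zero>\<^bsub>?Q\<^esub> \<in> carrier ?Q"
      unfolding Q(4) by (simp add: coset)
  next
    fix X assume "X \<in> carrier ?Q"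
    then show "\<exists>Y\<in>carrier ?Q. Y \<oplus>\<^bsub>?Q\<^esub> X = \<zero>\<^bsub>?Q\<^esub>"
    proof (rule rep)
      fix u assume u: "u \<in> carrier M" "X = N +>\<^bsub>M\<^esub> u"
      then show ?thesis
        by (intro bexI[of _ "N +>\<^bsub>M\<^esub> (\<ominus>\<^bsub>M\<^esub> u)"]) (simp_all add: Q(2,4) coset M.l_neg)
    qed
  qed (elim rep; simp add: Q(2,4) coset M.a_ac)+
  then show ?thesis
    by (intro left_module.intro left_module_axioms.intro R.ring_axioms)
      (assumption, (elim rep, simp add: Q(2,3) coset smult_l_distr smult_r_distr smult_assoc)+)
qed

text \<open>Taking images in \<open>M/N\<close> keeps inclusions strict, because submodules containing \<open>N\<close> are unions of
  cosets of \<open>N\<close>.\<close>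

lemma (in left_module) chain_le_quot_length:
  assumes N: "submodule N R M"
    and C: "\<And>i. i \<le> n \<Longrightarrow> submodule (C i) R M" "\<And>i. i \<le> n \<Longrightarrow> N \<subseteq> C i"
    and strict: "\<And>i. i < n \<Longrightarrow> C i \<subset> C (Suc i)"
  shows "enat n \<le> mod_length R (quot_module M N)"
proof -
  note Q = quot_module_ops[OF N]
  let ?Q = "quot_module M N"
  define D where "D i = (\<lambda>u. N +>\<^bsub>M\<^esub> u) ` C i" for i
  interpret Q: left_module R ?Q
    by (rule quot_module_left_module[OF N])
  have C_carr: "u \<in> carrier M" if "i \<le> n" "u \<in> C i" for i u
    using submoduleD(1)[OF C(1)[OF that(1)]] that(2) by auto
  have "submodule (D i) R ?Q" if i: "i \<le> n" for i
  proof (rule Q.submoduleI)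
    note Ci = submoduleD[OF C(1)[OF i]]
    show "D i \<subseteq> carrier ?Q"
      using Ci(1) unfolding D_def Q(1) by (rule image_mono)
    show "\<zero>\<^bsub>?Q\<^esub> \<in> D i"
      using Ci(2) unfolding D_def Q(4) by (rule imageI)
    show "u \<oplus>\<^bsub>?Q\<^esub> v \<in> D i" if "u \<in> D i" "v \<in> D i" for u v
      using that Ci(3) C_carr[OF i] unfolding D_def by (elim imageE) (simp add: Q(2))
    show "a \<odot>\<^bsub>?Q\<^esub> u \<in> D i" if "a \<in> carrier R" "u \<in> D i" for a u
      using that Ci(4) C_carr[OF i] unfolding D_def by (elim imageE) (simp add: Q(3))
  qed
  moreover have "D i \<subset> D (Suc i)" if i: "i < n" for i
  proof -
    obtain v where v: "v \<in> C (Suc i)" "v \<notin> C i"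
      using strict[OF i] by (meson psubset_imp_ex_mem DiffD1 DiffD2)
    have "N +>\<^bsub>M\<^esub> v \<notin> D i"
    proof
      assume "N +>\<^bsub>M\<^esub> v \<in> D i"
      then obtain u where u: "u \<in> C i" "N +>\<^bsub>M\<^esub> v = N +>\<^bsub>M\<^esub> u"
        unfolding D_def by (elim imageE)
      have "v = \<zero>\<^bsub>M\<^esub> \<oplus>\<^bsub>M\<^esub> v"
        using C_carr[of "Suc i" v] v(1) i by simp
      then have "v \<in> N +>\<^bsub>M\<^esub> v"
        using submoduleD(2)[OF N] by (auto simp: a_r_coset_def')
      then obtain w where "w \<in> N" "v = w \<oplus>\<^bsub>M\<^esub> u"
        unfolding u(2) by (auto simp: a_r_coset_def')
      moreover have "N \<subseteq> C i"
        using C(2) i by simp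
      ultimately have "v \<in> C i"
        using submoduleD(3)[OF C(1), of i w u] u(1) i by auto
      then show False
        using v(2) by simp
    qed
    moreover have "D i \<subseteq> D (Suc i)"
      using strict[OF i] unfolding D_def by (intro image_mono) simp
    moreover have "N +>\<^bsub>M\<^esub> v \<in> D (Suc i)"
      using v(1) unfolding D_def by (rule imageI)
    ultimately show ?thesis
      by (metis psubsetI)
  qed
  ultimately have "enat n \<in> {enat n | n. \<exists>N. (\<forall>i\<le>n. submodule (N i) R ?Q) \<and> (\<forall>i<n. N i \<subset> N (Suc i))}"
    by (intro CollectI exI[of _ n] conjI refl exI[of _ D]) simp_all
  then show ?thesis
    unfolding mod_length_def by (rule Sup_upper)
qed

text \<open>A finite supremum of a non-empty set of lengths is attained. The condition \<open>n > 0\<close> makes the set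
  non-empty, as the supremum of the empty set is \<open>0\<close>.\<close>

lemma mod_length_chain:
  assumes "mod_length R M = enat n" and "n > 0"
  shows "\<exists>N. (\<forall>i\<le>n. submodule (N i) R M) \<and> (\<forall>i<n. N i \<subset> N (Suc i))"
proof -
  let ?S = "{enat n | n. \<exists>N. (\<forall>i\<le>n. submodule (N i) R M) \<and> (\<forall>i<n. N i \<subset> N (Suc i))}"
  have S: "Sup ?S = enat n"
    using assms(1) by (simp add: mod_length_def)
  have ne: "?S \<noteq> {}"
  proof
    assume "?S = {}"
    then have "Sup ?S = 0"
      by (metis Sup_enat_def)
    then show False
      using S assms(2) by (simp add: zero_enat_def)
  qed
  have fin: "finite ?S"
  proof (rule ccontr)
    assume "infinite ?S"
    then have "Sup ?S = \<infinity>"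
      using ne by (simp only: Sup_enat_def if_False)
    then show False
      using S by simp
  qed
  have "Sup ?S = Max ?S"
    using ne fin by (simp only: Sup_enat_def if_False if_True)
  then have "enat n \<in> ?S"
    using Max_in[OF fin ne] S by simp
  then show ?thesis
    by simp
qed

section \<open>The radical of a local algebra\<close>

context local_algebra
begin

sublocale R: ring A
  by (rule ring_A)

sublocale V: Module.module K A
  by (rule vector_space_A)

abbreviation J :: "'a set" where
  "J \<equiv> radical A"

lemma maximal_left_ideal_eq_radical:
  "maximal_left_ideal L A \<longleftrightarrow> L = J"
proof -
  obtain I where I: "maximal_left_ideal I A" "\<And>L. maximal_left_ideal L A \<Longrightarrow> L = I"
    using local by metis
  have "{L. maximal_left_ideal L A} = {I}"
    using I by blast
  moreover have "submodule I A (left_regular A)"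
    using I(1) by (simp only: maximal_left_ideal_def)
  then have "I \<subseteq> carrier A"
    using submoduleD(1)[of I A "left_regular A"] by (simp add: left_regular_def)
  ultimately have "J = I"
    by (simp add: radical_def inf_absorb2)
  then show ?thesis
    using I by metis
qed

lemmas maximal_left_ideal_radical = maximal_left_ideal_eq_radical[THEN iffD2, OF refl]

lemma submodule_left_regularI:
  assumes "L \<subseteq> carrier A" "\<zero>\<^bsub>A\<^esub> \<in> L"
    and "\<And>u v. \<lbrakk>u \<in> L; v \<in> L\<rbrakk> \<Longrightarrow> u \<oplus>\<^bsub>A\<^esub> v \<in> L"
    and "\<And>a u. \<lbrakk>a \<in> carrier A; u \<in> L\<rbrakk> \<Longrightarrow> a \<otimes>\<^bsub>A\<^esub> u \<in> L"
  shows "submodule L A (left_regular A)"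
  using assms by (intro left_module.submoduleI left_regular_left_module ring_A)
    (simp_all add: left_regular_def)

lemma radical_left_ideal:
  shows "J \<subseteq> carrier A" and "\<zero>\<^bsub>A\<^esub> \<in> J"
    and "\<And>u v. \<lbrakk>u \<in> J; v \<in> J\<rbrakk> \<Longrightarrow> u \<oplus>\<^bsub>A\<^esub> v \<in> J"
    and "\<And>a u. \<lbrakk>a \<in> carrier A; u \<in> J\<rbrakk> \<Longrightarrow> a \<otimes>\<^bsub>A\<^esub> u \<in> J"
proof -
  have "submodule J A (left_regular A)"
    using maximal_left_ideal_radical by (simp add: maximal_left_ideal_def)
  from submoduleD[OF this] show "J \<subseteq> carrier A" and "\<zero>\<^bsub>A\<^esub> \<in> J"
    and "\<And>u v. \<lbrakk>u \<in> J; v \<in> J\<rbrakk> \<Longrightarrow> u \<oplus>\<^bsub>A\<^esub> v \<in> J"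
    and "\<And>a u. \<lbrakk>a \<in> carrier A; u \<in> J\<rbrakk> \<Longrightarrow> a \<otimes>\<^bsub>A\<^esub> u \<in> J"
    by (simp_all add: left_regular_def)
qed

lemma J_carrier: "j \<in> J \<Longrightarrow> j \<in> carrier A"
  using radical_left_ideal(1) by auto

text \<open>The left ideal \<open>A b + J\<close> properly contains the maximal left ideal \<open>J\<close>, so it is \<open>A\<close>.\<close>

lemma principal_plus_radical:
  assumes b: "b \<in> carrier A" "b \<notin> J" and a: "a \<in> carrier A"
  obtains c m where "c \<in> carrier A" "m \<in> J" "a = c \<otimes>\<^bsub>A\<^esub> b \<oplus>\<^bsub>A\<^esub> m"
proof -
  define U where "U = {c \<otimes>\<^bsub>A\<^esub> b \<oplus>\<^bsub>A\<^esub> m | c m. c \<in> carrier A \<and> m \<in> J}"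
  have UI: "c \<otimes>\<^bsub>A\<^esub> b \<oplus>\<^bsub>A\<^esub> m \<in> U" if "c \<in> carrier A" "m \<in> J" for c m
    using that unfolding U_def by blast
  have UE: thesis if "u \<in> U"
    "\<And>c m. \<lbrakk>c \<in> carrier A; m \<in> J; u = c \<otimes>\<^bsub>A\<^esub> b \<oplus>\<^bsub>A\<^esub> m\<rbrakk> \<Longrightarrow> thesis" for u thesis
    using that unfolding U_def by blast
  have U: "submodule U A (left_regular A)"
  proof (rule submodule_left_regularI)
    show "U \<subseteq> carrier A"
      using b J_carrier by (auto elim: UE)
    show "\<zero>\<^bsub>A\<^esub> \<in> U"
      using UI[of "\<zero>\<^bsub>A\<^esub>" "\<zero>\<^bsub>A\<^esub>"] radical_left_ideal(2) b by simp
  next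
    fix u v assume "u \<in> U" "v \<in> U"
    then show "u \<oplus>\<^bsub>A\<^esub> v \<in> U"
    proof (elim UE)
      fix c m c' m' assume *: "c \<in> carrier A" "m \<in> J" "c' \<in> carrier A" "m' \<in> J"
        "u = c \<otimes>\<^bsub>A\<^esub> b \<oplus>\<^bsub>A\<^esub> m" "v = c' \<otimes>\<^bsub>A\<^esub> b \<oplus>\<^bsub>A\<^esub> m'"
      then have "u \<oplus>\<^bsub>A\<^esub> v = (c \<oplus>\<^bsub>A\<^esub> c') \<otimes>\<^bsub>A\<^esub> b \<oplus>\<^bsub>A\<^esub> (m \<oplus>\<^bsub>A\<^esub> m')"
        using b J_carrier by (simp add: R.l_distr R.a_ac)
      then show ?thesis
        using UI[of "c \<oplus>\<^bsub>A\<^esub> c'" "m \<oplus>\<^bsub>A\<^esub> m'"] * radical_left_ideal(3) by simp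
    qed
  next
    fix r u assume r: "r \<in> carrier A" and "u \<in> U"
    from \<open>u \<in> U\<close> show "r \<otimes>\<^bsub>A\<^esub> u \<in> U"
    proof (rule UE)
      fix c m assume *: "c \<in> carrier A" "m \<in> J" "u = c \<otimes>\<^bsub>A\<^esub> b \<oplus>\<^bsub>A\<^esub> m"
      then have "r \<otimes>\<^bsub>A\<^esub> u = (r \<otimes>\<^bsub>A\<^esub> c) \<otimes>\<^bsub>A\<^esub> b \<oplus>\<^bsub>A\<^esub> r \<otimes>\<^bsub>A\<^esub> m"
        using r b J_carrier by (simp add: R.r_distr R.m_assoc)
      then show ?thesis
        using UI[of "r \<otimes>\<^bsub>A\<^esub> c" "r \<otimes>\<^bsub>A\<^esub> m"] * r radical_left_ideal(4) by simp
    qed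
  qed
  have "J \<subseteq> U"
  proof
    fix m assume "m \<in> J"
    then show "m \<in> U"
      using UI[of "\<zero>\<^bsub>A\<^esub>" m] b J_carrier by simp
  qed
  moreover have "b \<in> U"
    using UI[of "\<one>\<^bsub>A\<^esub>" "\<zero>\<^bsub>A\<^esub>"] radical_left_ideal(2) b by simp
  then have "U \<noteq> J"
    using b(2) by auto
  ultimately have "U = carrier A"
    using maximal_left_ideal_radical U unfolding maximal_left_ideal_def by metis
  then show thesis
    using UE[of a] a that by metis
qed

text \<open>For \<open>a \<notin> J\<close> right multiplication by \<open>a\<close> induces an epimorphism from \<open>A\<close> onto the simple module
  \<open>A/J\<close>. Its kernel \<open>{b. b a \<in> J}\<close> is a maximal left ideal, hence equal to \<open>J\<close>.\<close>

lemma radical_right_ideal: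
  assumes j: "j \<in> J" and a: "a \<in> carrier A"
  shows "j \<otimes>\<^bsub>A\<^esub> a \<in> J"
proof (cases "a \<in> J")
  case True
  then show ?thesis
    using radical_left_ideal(4) j J_carrier by simp
next
  case False
  define T where "T = {b \<in> carrier A. b \<otimes>\<^bsub>A\<^esub> a \<in> J}"
  have T: "submodule T A (left_regular A)"
    using a radical_left_ideal unfolding T_def
    by (intro submodule_left_regularI) (auto simp: R.l_distr R.m_assoc)
  have "L = carrier A" if L: "submodule L A (left_regular A)" "T \<subseteq> L" "L \<noteq> T" for L
  proof -
    note LI = submoduleD[OF L(1), unfolded left_regular_def, simplified]
    obtain b where b: "b \<in> L" "b \<notin> T"
      using L(2,3) by (metis subsetI subset_antisym)
    then have bc: "b \<in> carrier A"
      using LI(1) by auto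
    then have "b \<otimes>\<^bsub>A\<^esub> a \<notin> J"
      using b(2) by (simp add: T_def)
    then obtain c m where cm: "c \<in> carrier A" "m \<in> J" "a = c \<otimes>\<^bsub>A\<^esub> (b \<otimes>\<^bsub>A\<^esub> a) \<oplus>\<^bsub>A\<^esub> m"
      using principal_plus_radical[of "b \<otimes>\<^bsub>A\<^esub> a" a] bc a by auto
    have m: "m \<in> carrier A"
      using cm(2) by (rule J_carrier)
    define y where "y = c \<otimes>\<^bsub>A\<^esub> b"
    have y: "y \<in> carrier A" "y \<in> L" "a = y \<otimes>\<^bsub>A\<^esub> a \<oplus>\<^bsub>A\<^esub> m"
      using cm bc b(1) a LI(4) by (simp_all add: y_def R.m_assoc)
    \<comment> \<open>As \<open>a = y a + m\<close>, the element \<open>1 - y\<close> lies in \<open>T \<subseteq> L\<close>, and \<open>y = c b\<close> lies in \<open>L\<close>.\<close>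
    have "(\<one>\<^bsub>A\<^esub> \<oplus>\<^bsub>A\<^esub> \<ominus>\<^bsub>A\<^esub> y) \<otimes>\<^bsub>A\<^esub> a = \<ominus>\<^bsub>A\<^esub> (y \<otimes>\<^bsub>A\<^esub> a) \<oplus>\<^bsub>A\<^esub> a"
      using y(1) a by (simp add: R.l_distr R.l_minus R.a_comm)
    also have "\<dots> = \<ominus>\<^bsub>A\<^esub> (y \<otimes>\<^bsub>A\<^esub> a) \<oplus>\<^bsub>A\<^esub> (y \<otimes>\<^bsub>A\<^esub> a \<oplus>\<^bsub>A\<^esub> m)"
      using y(3) by metis
    also have "\<dots> = m"
      using y(1) a m by (simp add: R.r_neg1)
    finally have "\<one>\<^bsub>A\<^esub> \<oplus>\<^bsub>A\<^esub> \<ominus>\<^bsub>A\<^esub> y \<in> T"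
      using y(1) cm(2) by (simp add: T_def)
    then have "(\<one>\<^bsub>A\<^esub> \<oplus>\<^bsub>A\<^esub> \<ominus>\<^bsub>A\<^esub> y) \<oplus>\<^bsub>A\<^esub> y \<in> L"
      using LI(3) L(2) y(2) by (meson subsetD)
    then have one: "\<one>\<^bsub>A\<^esub> \<in> L"
      using y(1) by (simp add: R.a_assoc R.l_neg)
    have "carrier A \<subseteq> L"
    proof
      fix r assume "r \<in> carrier A"
      then show "r \<in> L"
        using LI(4)[of r "\<one>\<^bsub>A\<^esub>"] one by simp
    qed
    then show ?thesis
      using LI(1) by simp
  qed
  moreover have "\<one>\<^bsub>A\<^esub> \<notin> T"
    using False a by (simp add: T_def)
  then have "T \<noteq> carrier A"
    by auto
  ultimately have "maximal_left_ideal T A"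
    using T unfolding maximal_left_ideal_def by metis
  then have "T = J"
    by (simp only: maximal_left_ideal_eq_radical)
  then show ?thesis
    using j by (auto simp: T_def)
qed

lemma subspaceI:
  assumes sub: "N \<subseteq> carrier A" and "\<zero>\<^bsub>A\<^esub> \<in> N"
    and "\<And>u v. \<lbrakk>u \<in> N; v \<in> N\<rbrakk> \<Longrightarrow> u \<oplus>\<^bsub>A\<^esub> v \<in> N"
    and smul: "\<And>c u. \<lbrakk>c \<in> carrier K; u \<in> N\<rbrakk> \<Longrightarrow> c \<odot>\<^bsub>A\<^esub> u \<in> N"
  shows "submodule N K A"
proof (rule V.submoduleI)
  show "\<ominus>\<^bsub>A\<^esub> u \<in> N" if "u \<in> N" for u
  proof -
    have "u \<in> carrier A"
      using sub that by (rule subsetD)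
    then have "\<ominus>\<^bsub>A\<^esub> u = (\<ominus>\<^bsub>K\<^esub> \<one>\<^bsub>K\<^esub>) \<odot>\<^bsub>A\<^esub> u"
      by (simp add: V.smult_l_minus)
    then show ?thesis
      using smul[of "\<ominus>\<^bsub>K\<^esub> \<one>\<^bsub>K\<^esub>" u] that by simp
  qed
qed (use assms in simp_all)

lemma left_ideal_subspace:
  assumes "L \<subseteq> carrier A" "\<zero>\<^bsub>A\<^esub> \<in> L"
    and "\<And>u v. \<lbrakk>u \<in> L; v \<in> L\<rbrakk> \<Longrightarrow> u \<oplus>\<^bsub>A\<^esub> v \<in> L"
    and mult: "\<And>a u. \<lbrakk>a \<in> carrier A; u \<in> L\<rbrakk> \<Longrightarrow> a \<otimes>\<^bsub>A\<^esub> u \<in> L"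
  shows "submodule L K A"
proof (rule subspaceI)
  fix c u assume c: "c \<in> carrier K" and u: "u \<in> L"
  then have "u \<in> carrier A"
    using assms(1) by auto
  then show "c \<odot>\<^bsub>A\<^esub> u \<in> L"
    using mult[of "c \<odot>\<^bsub>A\<^esub> \<one>\<^bsub>A\<^esub>" u] smult_mult_left[of c "\<one>\<^bsub>A\<^esub>" u] c u by simp
qed (use assms in simp_all)

lemma radical_ideal: "ideal J A"
proof (rule idealI)
  show "subgroup J (add_monoid A)"
    using left_ideal_subspace[OF radical_left_ideal] by (rule submodule.axioms(1))
qed (simp_all add: radical_left_ideal radical_right_ideal ring_A)

lemma radical_sq_ideal: "ideal (radical_sq A) A"
  by (rule R.ideal_prod_is_ideal[OF radical_ideal radical_ideal])

lemma radical_sq_subset: "radical_sq A \<subseteq> J"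
  using R.ideal_prod_inter[OF radical_ideal radical_ideal] by simp

text \<open>Surjectivity of \<open>k \<rightarrow> A/J\<close> gives \<open>A = k + J\<close>.\<close>

lemma scalar_plus_radical:
  assumes a: "a \<in> carrier A"
  obtains c j where "c \<in> carrier K" "j \<in> J" "a = c \<odot>\<^bsub>A\<^esub> \<one>\<^bsub>A\<^esub> \<oplus>\<^bsub>A\<^esub> j"
proof -
  interpret J: ideal J A by (rule radical_ideal)
  have "J +>\<^bsub>A\<^esub> a \<in> carrier (A Quot J)"
    using R.a_rcosetsI[OF radical_left_ideal(1) a] by (simp add: FactRing_def)
  then have "J +>\<^bsub>A\<^esub> a \<in> (\<lambda>c. J +>\<^bsub>A\<^esub> (c \<odot>\<^bsub>A\<^esub> \<one>\<^bsub>A\<^esub>)) ` carrier K"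
    unfolding bij_betw_imp_surj_on[OF residue_field] .
  then obtain c where c: "c \<in> carrier K" "J +>\<^bsub>A\<^esub> a = J +>\<^bsub>A\<^esub> (c \<odot>\<^bsub>A\<^esub> \<one>\<^bsub>A\<^esub>)"
    by (elim imageE)
  have "a \<in> J +>\<^bsub>A\<^esub> (c \<odot>\<^bsub>A\<^esub> \<one>\<^bsub>A\<^esub>)"
    using J.a_rcos_self[OF a] unfolding c(2) .
  then have "\<exists>j\<in>J. a = j \<oplus>\<^bsub>A\<^esub> c \<odot>\<^bsub>A\<^esub> \<one>\<^bsub>A\<^esub>"
    by (simp add: a_r_coset_def')
  then obtain j where j: "j \<in> J" "a = j \<oplus>\<^bsub>A\<^esub> c \<odot>\<^bsub>A\<^esub> \<one>\<^bsub>A\<^esub>"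
    by (elim bexE)
  have "a = c \<odot>\<^bsub>A\<^esub> \<one>\<^bsub>A\<^esub> \<oplus>\<^bsub>A\<^esub> j"
    unfolding j(2) using J_carrier[OF j(1)] c(1) by (intro R.a_comm) simp_all
  then show ?thesis
    by (rule that[OF c(1) j(1)])
qed

lemma scalar_mult:
  assumes "c \<in> carrier K" "u \<in> carrier A"
  shows "(c \<odot>\<^bsub>A\<^esub> \<one>\<^bsub>A\<^esub>) \<otimes>\<^bsub>A\<^esub> u = c \<odot>\<^bsub>A\<^esub> u" and "u \<otimes>\<^bsub>A\<^esub> (c \<odot>\<^bsub>A\<^esub> \<one>\<^bsub>A\<^esub>) = c \<odot>\<^bsub>A\<^esub> u"
  using assms smult_mult_left[of c "\<one>\<^bsub>A\<^esub>" u] smult_mult_right[of c u "\<one>\<^bsub>A\<^esub>"] by simp_all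

lemma smult_eq_zero:
  assumes "c \<in> carrier K" "c \<noteq> \<zero>\<^bsub>K\<^esub>" "u \<in> carrier A" "c \<odot>\<^bsub>A\<^esub> u = \<zero>\<^bsub>A\<^esub>"
  shows "u = \<zero>\<^bsub>A\<^esub>"
proof -
  interpret K: field K by (rule field_K)
  have inv: "inv\<^bsub>K\<^esub> c \<in> carrier K" "inv\<^bsub>K\<^esub> c \<otimes>\<^bsub>K\<^esub> c = \<one>\<^bsub>K\<^esub>"
    using assms(1,2) K.field_Units by auto
  have "u = (inv\<^bsub>K\<^esub> c \<otimes>\<^bsub>K\<^esub> c) \<odot>\<^bsub>A\<^esub> u"
    using inv(2) assms(3) by simp
  also have "\<dots> = inv\<^bsub>K\<^esub> c \<odot>\<^bsub>A\<^esub> (c \<odot>\<^bsub>A\<^esub> u)"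
    using inv(1) assms(1,3) by (rule V.smult_assoc1)
  finally show ?thesis
    using assms(4) inv(1) by simp
qed

end

section \<open>Short local algebras\<close>

context short_local_algebra
begin

lemma radical_sq_mult_radical:
  assumes "b \<in> radical_sq A" "j \<in> J"
  shows "b \<otimes>\<^bsub>A\<^esub> j = \<zero>\<^bsub>A\<^esub>"
  using ideal_prod.prod[OF assms, of A] short by simp

lemma radical_mult_radical_sq:
  assumes j: "j \<in> J" and b: "b \<in> radical_sq A"
  shows "j \<otimes>\<^bsub>A\<^esub> b = \<zero>\<^bsub>A\<^esub>"
proof -
  have "b \<in> carrier A \<and> j \<otimes>\<^bsub>A\<^esub> b = \<zero>\<^bsub>A\<^esub>"
    using b
  proof induction
    case (prod i l)
    then have "(j \<otimes>\<^bsub>A\<^esub> i) \<otimes>\<^bsub>A\<^esub> l = \<zero>\<^bsub>A\<^esub>"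
      by (intro radical_sq_mult_radical ideal_prod.prod j)
    then show ?case
      using prod j J_carrier by (simp add: R.m_assoc)
  next
    case (sum s1 s2)
    then show ?case
      using j J_carrier by (simp add: R.r_distr)
  qed
  then show ?thesis ..
qed

lemma radical_cubed:
  assumes "i \<in> J" "j \<in> J" "l \<in> J"
  shows "i \<otimes>\<^bsub>A\<^esub> (j \<otimes>\<^bsub>A\<^esub> l) = \<zero>\<^bsub>A\<^esub>" and "i \<otimes>\<^bsub>A\<^esub> j \<otimes>\<^bsub>A\<^esub> l = \<zero>\<^bsub>A\<^esub>"
  by (intro radical_mult_radical_sq radical_sq_mult_radical ideal_prod.prod assms)+

text \<open>Elements outside the radical are not zero divisors: such a \<open>u\<close> is \<open>c + j\<close> with a scalar \<open>c \<noteq> 0\<close>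
  and \<open>j \<in> J\<close>. From \<open>u a = 0\<close> one gets \<open>c v a = - v j a\<close> for all \<open>v\<close>, so that \<open>v j a = 0\<close> implies
  \<open>v a = 0\<close>. Starting from \<open>j\<^sup>3 a = 0\<close> this yields \<open>j\<^sup>2 a = 0\<close>, \<open>j a = 0\<close> and \<open>a = 0\<close>. The case \<open>a u = 0\<close>
  is symmetric.\<close>

lemma annihilator_radical:
  assumes u: "u \<in> carrier A" and a: "a \<in> carrier A" "a \<noteq> \<zero>\<^bsub>A\<^esub>"
    and zero: "u \<otimes>\<^bsub>A\<^esub> a = \<zero>\<^bsub>A\<^esub> \<or> a \<otimes>\<^bsub>A\<^esub> u = \<zero>\<^bsub>A\<^esub>"
  shows "u \<in> J"
proof (rule ccontr)
  assume nJ: "u \<notin> J"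
  obtain c j where cj: "c \<in> carrier K" "j \<in> J" "u = c \<odot>\<^bsub>A\<^esub> \<one>\<^bsub>A\<^esub> \<oplus>\<^bsub>A\<^esub> j"
    using scalar_plus_radical[OF u] .
  have j: "j \<in> carrier A"
    using cj(2) by (rule J_carrier)
  have c: "c \<noteq> \<zero>\<^bsub>K\<^esub>"
    using cj nJ j by (auto simp: V.smult_l_null)
  note smult0 = smult_eq_zero[OF cj(1) c]
  have JJJ: "j \<otimes>\<^bsub>A\<^esub> (j \<otimes>\<^bsub>A\<^esub> j) = \<zero>\<^bsub>A\<^esub>"
    using radical_cubed(1) cj(2) by simp
  from zero show False
  proof
    assume "u \<otimes>\<^bsub>A\<^esub> a = \<zero>\<^bsub>A\<^esub>"
    then have eq: "c \<odot>\<^bsub>A\<^esub> a \<oplus>\<^bsub>A\<^esub> j \<otimes>\<^bsub>A\<^esub> a = \<zero>\<^bsub>A\<^esub>"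
      using cj(1,3) j a(1) by (simp add: R.l_distr scalar_mult)
    have step: "v \<otimes>\<^bsub>A\<^esub> a = \<zero>\<^bsub>A\<^esub>" if "v \<in> carrier A" "v \<otimes>\<^bsub>A\<^esub> j \<otimes>\<^bsub>A\<^esub> a = \<zero>\<^bsub>A\<^esub>" for v
    proof (rule smult0)
      have "v \<otimes>\<^bsub>A\<^esub> (c \<odot>\<^bsub>A\<^esub> a \<oplus>\<^bsub>A\<^esub> j \<otimes>\<^bsub>A\<^esub> a) = c \<odot>\<^bsub>A\<^esub> (v \<otimes>\<^bsub>A\<^esub> a) \<oplus>\<^bsub>A\<^esub> v \<otimes>\<^bsub>A\<^esub> j \<otimes>\<^bsub>A\<^esub> a"
        using that(1) cj(1) a(1) j by (simp add: R.r_distr R.m_assoc smult_mult_right)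
      then show "c \<odot>\<^bsub>A\<^esub> (v \<otimes>\<^bsub>A\<^esub> a) = \<zero>\<^bsub>A\<^esub>"
        using that cj(1) a(1) unfolding eq by simp
    qed (use that a in simp)
    have "j \<otimes>\<^bsub>A\<^esub> j \<otimes>\<^bsub>A\<^esub> j \<otimes>\<^bsub>A\<^esub> a = \<zero>\<^bsub>A\<^esub>"
      using radical_cubed(2) cj(2) a(1) by simp
    then have "j \<otimes>\<^bsub>A\<^esub> j \<otimes>\<^bsub>A\<^esub> a = \<zero>\<^bsub>A\<^esub>"
      using j by - (rule step, simp_all)
    then have "j \<otimes>\<^bsub>A\<^esub> a = \<zero>\<^bsub>A\<^esub>"
      using j by - (rule step)
    then have "\<one>\<^bsub>A\<^esub> \<otimes>\<^bsub>A\<^esub> a = \<zero>\<^bsub>A\<^esub>"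
      using j by - (rule step, simp_all)
    then show False
      using a by simp
  next
    assume "a \<otimes>\<^bsub>A\<^esub> u = \<zero>\<^bsub>A\<^esub>"
    then have eq: "c \<odot>\<^bsub>A\<^esub> a \<oplus>\<^bsub>A\<^esub> a \<otimes>\<^bsub>A\<^esub> j = \<zero>\<^bsub>A\<^esub>"
      using cj(1,3) j a(1) by (simp add: R.r_distr scalar_mult)
    have step: "a \<otimes>\<^bsub>A\<^esub> v = \<zero>\<^bsub>A\<^esub>" if "v \<in> carrier A" "a \<otimes>\<^bsub>A\<^esub> (j \<otimes>\<^bsub>A\<^esub> v) = \<zero>\<^bsub>A\<^esub>" for v
    proof (rule smult0)
      have "(c \<odot>\<^bsub>A\<^esub> a \<oplus>\<^bsub>A\<^esub> a \<otimes>\<^bsub>A\<^esub> j) \<otimes>\<^bsub>A\<^esub> v = c \<odot>\<^bsub>A\<^esub> (a \<otimes>\<^bsub>A\<^esub> v) \<oplus>\<^bsub>A\<^esub> a \<otimes>\<^bsub>A\<^esub> (j \<otimes>\<^bsub>A\<^esub> v)"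
        using that(1) cj(1) a(1) j by (simp add: R.l_distr R.m_assoc smult_mult_left)
      then show "c \<odot>\<^bsub>A\<^esub> (a \<otimes>\<^bsub>A\<^esub> v) = \<zero>\<^bsub>A\<^esub>"
        using that cj(1) a(1) unfolding eq by simp
    qed (use that a in simp)
    have "a \<otimes>\<^bsub>A\<^esub> (j \<otimes>\<^bsub>A\<^esub> (j \<otimes>\<^bsub>A\<^esub> j)) = \<zero>\<^bsub>A\<^esub>"
      using JJJ a(1) by simp
    then have "a \<otimes>\<^bsub>A\<^esub> (j \<otimes>\<^bsub>A\<^esub> j) = \<zero>\<^bsub>A\<^esub>"
      using j by - (rule step, simp_all)
    then have "a \<otimes>\<^bsub>A\<^esub> j = \<zero>\<^bsub>A\<^esub>"
      using j by - (rule step)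
    then have "a \<otimes>\<^bsub>A\<^esub> \<one>\<^bsub>A\<^esub> = \<zero>\<^bsub>A\<^esub>"
      using j by - (rule step, simp_all)
    then show False
      using a by simp
  qed
qed

text \<open>An element \<open>c + j\<close> of \<open>k + J = A\<close> maps \<open>n \<in> N\<close> to \<open>c n + j n\<close>, and \<open>j n \<in> J\<^sup>2 \<subseteq> N\<close>.\<close>

lemma subspace_submodule:
  assumes N: "submodule N K A" "radical_sq A \<subseteq> N" "N \<subseteq> J"
  shows "submodule N A ((left_regular A)\<lparr>carrier := J\<rparr>)"
proof (rule left_module.submoduleI)
  note NK = submoduleD[OF N(1)]
  show "left_module A ((left_regular A)\<lparr>carrier := J\<rparr>)"
    using maximal_left_ideal_radical unfolding maximal_left_ideal_def
    by (intro left_module.submodule_left_module left_regular_left_module ring_A) simp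
  fix a n assume a: "a \<in> carrier A" and n: "n \<in> N"
  have nJ: "n \<in> J"
    using N(3) n by (rule subsetD)
  obtain c j where cj: "c \<in> carrier K" "j \<in> J" "a = c \<odot>\<^bsub>A\<^esub> \<one>\<^bsub>A\<^esub> \<oplus>\<^bsub>A\<^esub> j"
    using scalar_plus_radical[OF a] .
  have "a \<otimes>\<^bsub>A\<^esub> n = c \<odot>\<^bsub>A\<^esub> n \<oplus>\<^bsub>A\<^esub> j \<otimes>\<^bsub>A\<^esub> n"
    unfolding cj(3) using cj(1) J_carrier[OF cj(2)] J_carrier[OF nJ]
    by (simp add: R.l_distr scalar_mult)
  moreover have "j \<otimes>\<^bsub>A\<^esub> n \<in> N"
    using ideal_prod.prod[OF cj(2) nJ] N(2) by (rule subsetD[rotated])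
  ultimately show "a \<odot>\<^bsub>(left_regular A)\<lparr>carrier := J\<rparr>\<^esub> n \<in> N"
    using NK(3,4) cj(1) n by (simp add: left_regular_def)
qed (use submoduleD[OF N(1)] N(3) in \<open>simp_all add: left_regular_def\<close>)

lemma submodule_radical_sq_subspace:
  assumes "submodule N A ((left_regular A)\<lparr>carrier := radical_sq A\<rparr>)"
  shows "submodule N K A" and "N \<subseteq> radical_sq A"
proof -
  note N = submoduleD[OF assms, unfolded left_regular_def, simplified]
  show "N \<subseteq> radical_sq A"
    by (rule N(1))
  then have "N \<subseteq> carrier A"
    using radical_sq_subset radical_left_ideal(1) by simp
  then show "submodule N K A"
    by (rule left_ideal_subspace) (rule N; assumption)+
qed

lemma radical_sq_subspace: "submodule (radical_sq A) K A"
proof -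
  interpret I: ideal "radical_sq A" A
    by (rule radical_sq_ideal)
  show ?thesis
    by (rule left_ideal_subspace[OF I.a_subset I.zero_closed]) (simp_all add: I.I_l_closed)
qed

text \<open>The map \<open>\<phi>\<close> stands for the right or the left multiplication by \<open>x\<close>. It induces a surjection from
  \<open>J/J\<^sup>2\<close>, of length \<open>e\<close>, onto \<open>J\<^sup>2\<close>, of length \<open>e - 1\<close>, whose kernel contains the non-zero class of
  \<open>x\<close>. An element \<open>a\<close> of the kernel outside \<open>W = k x + J\<^sup>2\<close> would give the chain
  \<open>J\<^sup>2 \<subset> W \<subset> \<phi>\<^sup>-\<^sup>1(N 0) \<subset> \<dots> \<subset> \<phi>\<^sup>-\<^sup>1(N (e - 1))\<close> of length \<open>e + 1\<close> between \<open>J\<^sup>2\<close> and \<open>J\<close>, for a chain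
  \<open>N\<close> of length \<open>e - 1\<close> in \<open>J\<^sup>2\<close>. The map is required to be \<open>k\<close>-linear and not
  \<open>A\<close>-linear because the left multiplication is not a homomorphism of left modules.\<close>

lemma radical_map_kernel:
  assumes e: "e \<ge> 2" "hilbert_type A = (enat e, enat (e - 1))"
    and add: "\<And>u v. \<lbrakk>u \<in> carrier A; v \<in> carrier A\<rbrakk> \<Longrightarrow> \<phi> (u \<oplus>\<^bsub>A\<^esub> v) = \<phi> u \<oplus>\<^bsub>A\<^esub> \<phi> v"
    and smul: "\<And>c u. \<lbrakk>c \<in> carrier K; u \<in> carrier A\<rbrakk> \<Longrightarrow> \<phi> (c \<odot>\<^bsub>A\<^esub> u) = c \<odot>\<^bsub>A\<^esub> \<phi> u"
    and onto: "\<phi> ` J = radical_sq A"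
    and null: "\<And>b. b \<in> radical_sq A \<Longrightarrow> \<phi> b = \<zero>\<^bsub>A\<^esub>"
    and x: "x \<in> J" "x \<notin> radical_sq A" "\<phi> x = \<zero>\<^bsub>A\<^esub>"
    and a: "a \<in> J" "\<phi> a = \<zero>\<^bsub>A\<^esub>"
  shows "\<exists>c\<in>carrier K. \<exists>b\<in>radical_sq A. a = c \<odot>\<^bsub>A\<^esub> x \<oplus>\<^bsub>A\<^esub> b"
proof (rule ccontr)
  define W where "W = {c \<odot>\<^bsub>A\<^esub> x \<oplus>\<^bsub>A\<^esub> b | c b. c \<in> carrier K \<and> b \<in> radical_sq A}"
  define pre where "pre N = {u \<in> J. \<phi> u \<in> N}" for N
  have WI: "c \<odot>\<^bsub>A\<^esub> x \<oplus>\<^bsub>A\<^esub> b \<in> W" if "c \<in> carrier K" "b \<in> radical_sq A" for c b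
    unfolding W_def using that by blast
  have WE: thesis if "w \<in> W"
    "\<And>c b. \<lbrakk>c \<in> carrier K; b \<in> radical_sq A; w = c \<odot>\<^bsub>A\<^esub> x \<oplus>\<^bsub>A\<^esub> b\<rbrakk> \<Longrightarrow> thesis" for w thesis
    using that(1) unfolding W_def by (elim CollectE exE conjE) (rule that(2))
  assume "\<not> ?thesis"
  then have aW: "a \<notin> W"
    by (metis WE)
  have xc: "x \<in> carrier A"
    using x(1) by (rule J_carrier)
  note J2 = submoduleD[OF radical_sq_subspace]
  have J2c: "b \<in> carrier A" if "b \<in> radical_sq A" for b
    using J2(1) that by (rule subsetD)
  have J2J: "b \<in> J" if "b \<in> radical_sq A" for b
    using radical_sq_subset that by (rule subsetD)
  have JK: "c \<odot>\<^bsub>A\<^esub> u \<in> J" if "c \<in> carrier K" "u \<in> J" for c u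
    using submoduleD(4)[OF left_ideal_subspace[OF radical_left_ideal]] that by simp
  have W: "submodule W K A"
  proof (rule subspaceI)
    show "W \<subseteq> carrier A"
      using xc J2c by (intro subsetI) (elim WE, simp)
    show "\<zero>\<^bsub>A\<^esub> \<in> W"
      using WI[of "\<zero>\<^bsub>K\<^esub>" "\<zero>\<^bsub>A\<^esub>"] J2(2) xc by (simp add: V.smult_l_null)
  next
    fix u v assume "u \<in> W" "v \<in> W"
    then show "u \<oplus>\<^bsub>A\<^esub> v \<in> W"
    proof (elim WE)
      fix c b c' b' assume *: "c \<in> carrier K" "b \<in> radical_sq A" "c' \<in> carrier K" "b' \<in> radical_sq A"
        "u = c \<odot>\<^bsub>A\<^esub> x \<oplus>\<^bsub>A\<^esub> b" "v = c' \<odot>\<^bsub>A\<^esub> x \<oplus>\<^bsub>A\<^esub> b'"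
      have "u \<oplus>\<^bsub>A\<^esub> v = (c \<oplus>\<^bsub>K\<^esub> c') \<odot>\<^bsub>A\<^esub> x \<oplus>\<^bsub>A\<^esub> (b \<oplus>\<^bsub>A\<^esub> b')"
        unfolding *(5,6) using *(1-4) xc J2c by (simp add: V.smult_l_distr R.a_ac)
      then show ?thesis
        using WI[of "c \<oplus>\<^bsub>K\<^esub> c'" "b \<oplus>\<^bsub>A\<^esub> b'"] *(1-4) J2(3) by simp
    qed
  next
    fix r u assume r: "r \<in> carrier K" and "u \<in> W"
    from \<open>u \<in> W\<close> show "r \<odot>\<^bsub>A\<^esub> u \<in> W"
    proof (rule WE)
      fix c b assume *: "c \<in> carrier K" "b \<in> radical_sq A" "u = c \<odot>\<^bsub>A\<^esub> x \<oplus>\<^bsub>A\<^esub> b"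
      have "r \<odot>\<^bsub>A\<^esub> u = (r \<otimes>\<^bsub>K\<^esub> c) \<odot>\<^bsub>A\<^esub> x \<oplus>\<^bsub>A\<^esub> r \<odot>\<^bsub>A\<^esub> b"
        unfolding *(3) using *(1,2) r xc J2c by (simp add: V.smult_r_distr V.smult_assoc1)
      then show ?thesis
        using WI[of "r \<otimes>\<^bsub>K\<^esub> c" "r \<odot>\<^bsub>A\<^esub> b"] *(1,2) r J2(4) by simp
    qed
  qed
  have W_J2: "radical_sq A \<subseteq> W"
  proof
    fix b assume "b \<in> radical_sq A"
    then show "b \<in> W"
      using WI[of "\<zero>\<^bsub>K\<^esub>" b] xc J2c by (simp add: V.smult_l_null)
  qed
  have xW: "x \<in> W"
    using WI[of "\<one>\<^bsub>K\<^esub>" "\<zero>\<^bsub>A\<^esub>"] J2(2) xc by simp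
  have W_ker: "w \<in> J \<and> \<phi> w = \<zero>\<^bsub>A\<^esub>" if "w \<in> W" for w
    using that
  proof (rule WE)
    fix c b assume *: "c \<in> carrier K" "b \<in> radical_sq A" "w = c \<odot>\<^bsub>A\<^esub> x \<oplus>\<^bsub>A\<^esub> b"
    show ?thesis
      unfolding *(3) using *(1,2) x(1,3) xc J2c J2J null
      by (simp add: add smul JK radical_left_ideal(3) V.smult_r_null)
  qed
  have len: "mod_length A ((left_regular A)\<lparr>carrier := radical_sq A\<rparr>) = enat (e - 1)" "e - 1 > 0"
    using e by (simp_all add: hilbert_type_def)
  obtain N where "\<forall>i\<le>e - 1. submodule (N i) A ((left_regular A)\<lparr>carrier := radical_sq A\<rparr>)"
    "\<forall>i<e - 1. N i \<subset> N (Suc i)"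
    using mod_length_chain[OF len] by (elim exE conjE)
  then have N: "i \<le> e - 1 \<Longrightarrow> submodule (N i) A ((left_regular A)\<lparr>carrier := radical_sq A\<rparr>)"
    "i < e - 1 \<Longrightarrow> N i \<subset> N (Suc i)" for i
    by simp_all
  note NK = submodule_radical_sq_subspace[OF N(1)]
  have pre: "submodule (pre (N i)) K A" "radical_sq A \<subseteq> pre (N i)" "pre (N i) \<subseteq> J" "W \<subseteq> pre (N i)"
    if i: "i \<le> e - 1" for i
  proof -
    note Ni = submoduleD[OF NK(1)[OF i]]
    show "pre (N i) \<subseteq> J"
      by (simp add: pre_def)
    show W_pre: "W \<subseteq> pre (N i)"
      using W_ker Ni(2) by (intro subsetI) (simp add: pre_def)
    then show J2_pre: "radical_sq A \<subseteq> pre (N i)"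
      using W_J2 by (rule order_trans[rotated])
    show "submodule (pre (N i)) K A"
    proof (rule subspaceI)
      show "pre (N i) \<subseteq> carrier A"
        by (intro subsetI) (simp add: pre_def J_carrier)
      show "\<zero>\<^bsub>A\<^esub> \<in> pre (N i)"
        using J2_pre J2(2) by (rule subsetD)
    qed (simp_all add: pre_def add smul J_carrier Ni(3,4) radical_left_ideal(3) JK)
  qed
  have strict: "pre (N i) \<subset> pre (N (Suc i))" if i: "i < e - 1" for i
  proof -
    have sub: "pre (N i) \<subseteq> pre (N (Suc i))"
      using N(2)[OF i] by (intro subsetI) (simp add: pre_def psubset_eq subset_iff)
    obtain v where v: "v \<in> N (Suc i)" "v \<notin> N i"
      using psubset_imp_ex_mem[OF N(2)[OF i]] by (elim exE DiffE)
    have "v \<in> \<phi> ` J"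
      unfolding onto using NK(2)[of "Suc i"] i v(1) by (simp add: subset_iff)
    then obtain u where "u \<in> J" "v = \<phi> u"
      by (elim imageE)
    then have "u \<in> pre (N (Suc i))" "u \<notin> pre (N i)"
      using v by (simp_all add: pre_def)
    then show ?thesis
      using sub by (metis psubsetI)
  qed
  define C where "C i = (case i of 0 \<Rightarrow> radical_sq A | Suc k \<Rightarrow> (case k of 0 \<Rightarrow> W | Suc l \<Rightarrow> pre (N l)))" for i
  have C: "submodule (C i) K A \<and> radical_sq A \<subseteq> C i \<and> C i \<subseteq> J" if "i \<le> Suc e" for i
  proof -
    have "W \<subseteq> J"
      using W_ker by (intro subsetI) simp
    then show ?thesis
      using that e(1) radical_sq_subspace radical_sq_subset W W_J2 pre(1-3)
      by (simp add: C_def split: nat.split)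
  qed
  have C_strict: "C i \<subset> C (Suc i)" if i: "i < Suc e" for i
  proof -
    have "radical_sq A \<subset> W"
      using W_J2 xW x(2) by (metis psubsetI)
    moreover have "a \<in> pre (N 0)"
      using a submoduleD(2)[OF NK(1)[of 0]] by (simp add: pre_def)
    then have "W \<subset> pre (N 0)"
      using pre(4)[of 0] aW by (metis psubsetI le0)
    ultimately show ?thesis
      using i e(1) strict by (simp add: C_def split: nat.split)
  qed
  let ?JM = "(left_regular A)\<lparr>carrier := J\<rparr>"
  have "enat (Suc e) \<le> mod_length A (quot_module ?JM (radical_sq A))"
  proof (rule left_module.chain_le_quot_length[where C = C])
    show "left_module A ?JM"
      using maximal_left_ideal_radical unfolding maximal_left_ideal_def
      by (intro left_module.submodule_left_module left_regular_left_module ring_A) simp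
    show "submodule (radical_sq A) A ?JM"
      by (rule subspace_submodule[OF radical_sq_subspace order_refl radical_sq_subset])
    show "submodule (C i) A ?JM" "radical_sq A \<subseteq> C i" if "i \<le> Suc e" for i
      using C[OF that] subspace_submodule[of "C i"] by simp_all
  qed (rule C_strict)
  also have "\<dots> = enat e"
    using e(2) by (simp add: hilbert_type_def)
  finally show False
    by simp
qed

section \<open>Annihilators of Conca elements\<close>

text \<open>If \<open>x \<in> J\<^sup>2\<close>, then \<open>J\<^sup>2 = J x = 0\<close>, which leaves no room for a chain of length \<open>e - 1 \<ge> 1\<close>.\<close>

lemma conca_not_radical_sq:
  assumes e: "e \<ge> 2" "hilbert_type A = (enat e, enat (e - 1))" and x: "left_conca A x"
  shows "x \<notin> radical_sq A"
proof
  assume xJ2: "x \<in> radical_sq A"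
  have "radical_sq A = (\<Union>j\<in>J. {j \<otimes>\<^bsub>A\<^esub> x})"
    using x by (simp add: left_conca_def r_coset_def)
  also have "\<dots> \<subseteq> {\<zero>\<^bsub>A\<^esub>}"
    using radical_mult_radical_sq xJ2 by (intro UN_least) simp
  finally have J2: "radical_sq A \<subseteq> {\<zero>\<^bsub>A\<^esub>}" .
  have len: "mod_length A ((left_regular A)\<lparr>carrier := radical_sq A\<rparr>) = enat (e - 1)" "e - 1 > 0"
    using e by (simp_all add: hilbert_type_def)
  obtain N where "\<forall>i\<le>e - 1. submodule (N i) A ((left_regular A)\<lparr>carrier := radical_sq A\<rparr>)"
    "\<forall>i<e - 1. N i \<subset> N (Suc i)"
    using mod_length_chain[OF len] by (elim exE conjE)
  then have N: "i \<le> e - 1 \<Longrightarrow> submodule (N i) A ((left_regular A)\<lparr>carrier := radical_sq A\<rparr>)"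
    "i < e - 1 \<Longrightarrow> N i \<subset> N (Suc i)" for i
    by simp_all
  have "N 1 \<subseteq> {\<zero>\<^bsub>A\<^esub>}"
    using submodule_radical_sq_subspace(2)[OF N(1)] len(2) J2 by (intro order_trans[OF _ J2]) simp
  moreover have "\<zero>\<^bsub>A\<^esub> \<in> N 0"
    using submoduleD(2)[OF submodule_radical_sq_subspace(1)[OF N(1)], of 0] by simp
  moreover have "N 0 \<subset> N 1"
    using N(2)[of 0] e(1) by simp
  ultimately show False
    by auto
qed

text \<open>As \<open>x x = 0\<close>, the element \<open>x\<close> is itself a zero divisor and hence lies in \<open>J\<close>. The kernel of
  \<open>r(x)\<close> is \<open>k x + J\<^sup>2\<close>, and this is \<open>A x = (k + J) x\<close> because \<open>J\<^sup>2 = J x\<close>.\<close>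

lemma left_conca_kernel:
  assumes e: "e \<ge> 2" "hilbert_type A = (enat e, enat (e - 1))" and x: "left_conca A x"
  shows "x \<in> J" and "{a \<in> carrier A. a \<otimes>\<^bsub>A\<^esub> x = \<zero>\<^bsub>A\<^esub>} = carrier A #>\<^bsub>A\<^esub> x"
proof -
  have xA: "x \<in> carrier A" "x \<noteq> \<zero>\<^bsub>A\<^esub>" "x \<otimes>\<^bsub>A\<^esub> x = \<zero>\<^bsub>A\<^esub>" "radical_sq A = J #>\<^bsub>A\<^esub> x"
    using x unfolding left_conca_def by simp_all
  then have onto: "(\<lambda>a. a \<otimes>\<^bsub>A\<^esub> x) ` J = radical_sq A"
    by (simp add: r_coset_def UNION_singleton_eq_range)
  show xJ: "x \<in> J"
    using annihilator_radical[of x x] xA by simp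
  show "{a \<in> carrier A. a \<otimes>\<^bsub>A\<^esub> x = \<zero>\<^bsub>A\<^esub>} = carrier A #>\<^bsub>A\<^esub> x"
  proof (intro equalityI subsetI)
    fix a assume "a \<in> carrier A #>\<^bsub>A\<^esub> x"
    then obtain b where b: "b \<in> carrier A" "a = b \<otimes>\<^bsub>A\<^esub> x"
      by (auto simp: r_coset_def)
    show "a \<in> {a \<in> carrier A. a \<otimes>\<^bsub>A\<^esub> x = \<zero>\<^bsub>A\<^esub>}"
      unfolding b(2) using b(1) xA(1,3) by (simp add: R.m_assoc)
  next
    fix a assume "a \<in> {a \<in> carrier A. a \<otimes>\<^bsub>A\<^esub> x = \<zero>\<^bsub>A\<^esub>}"
    then have a: "a \<in> carrier A" "a \<otimes>\<^bsub>A\<^esub> x = \<zero>\<^bsub>A\<^esub>"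
      by simp_all
    have aJ: "a \<in> J"
      using annihilator_radical[OF a(1) xA(1,2)] a(2) by simp
    have "\<exists>c\<in>carrier K. \<exists>b\<in>radical_sq A. a = c \<odot>\<^bsub>A\<^esub> x \<oplus>\<^bsub>A\<^esub> b"
    proof (rule radical_map_kernel[OF e, where \<phi> = "\<lambda>a. a \<otimes>\<^bsub>A\<^esub> x"])
      show "b \<otimes>\<^bsub>A\<^esub> x = \<zero>\<^bsub>A\<^esub>" if "b \<in> radical_sq A" for b
        using that xJ by (rule radical_sq_mult_radical)
    qed (use xA(1,3) xJ conca_not_radical_sq[OF e x] onto aJ a(2) in
        \<open>simp_all add: R.l_distr smult_mult_left\<close>)
    then obtain c b where cb: "c \<in> carrier K" "b \<in> radical_sq A" "a = c \<odot>\<^bsub>A\<^esub> x \<oplus>\<^bsub>A\<^esub> b"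
      by (elim bexE)
    have "b \<in> (\<lambda>a. a \<otimes>\<^bsub>A\<^esub> x) ` J"
      unfolding onto by (rule cb(2))
    then obtain j where j: "j \<in> J" "b = j \<otimes>\<^bsub>A\<^esub> x"
      by (elim imageE)
    have "a = (c \<odot>\<^bsub>A\<^esub> \<one>\<^bsub>A\<^esub> \<oplus>\<^bsub>A\<^esub> j) \<otimes>\<^bsub>A\<^esub> x"
      unfolding cb(3) j(2) using cb(1) J_carrier[OF j(1)] xA(1) by (simp add: R.l_distr scalar_mult)
    moreover have "c \<odot>\<^bsub>A\<^esub> \<one>\<^bsub>A\<^esub> \<oplus>\<^bsub>A\<^esub> j \<in> carrier A"
      using cb(1) J_carrier[OF j(1)] by simp
    ultimately show "a \<in> carrier A #>\<^bsub>A\<^esub> x"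
      unfolding r_coset_def by (intro UN_I) simp_all
  qed
qed

text \<open>The mirror image for the left multiplication, where \<open>J\<^sup>2 = x J\<close> gives \<open>k x + J\<^sup>2 = x A\<close>.\<close>

lemma conca_kernel:
  assumes e: "e \<ge> 2" "hilbert_type A = (enat e, enat (e - 1))" and x: "conca A x"
  shows "{a \<in> carrier A. x \<otimes>\<^bsub>A\<^esub> a = \<zero>\<^bsub>A\<^esub>} = x <#\<^bsub>A\<^esub> carrier A"
proof -
  have xA: "x \<in> carrier A" "x \<noteq> \<zero>\<^bsub>A\<^esub>" "x \<otimes>\<^bsub>A\<^esub> x = \<zero>\<^bsub>A\<^esub>" "radical_sq A = x <#\<^bsub>A\<^esub> J"
    and left: "left_conca A x"
    using x unfolding conca_def left_conca_def by metis+
  have onto: "(\<lambda>a. x \<otimes>\<^bsub>A\<^esub> a) ` J = radical_sq A"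
    unfolding xA(4) by (simp add: l_coset_def UNION_singleton_eq_range)
  have xJ: "x \<in> J"
    by (rule left_conca_kernel(1)[OF e left])
  show ?thesis
  proof (intro equalityI subsetI)
    fix a assume "a \<in> x <#\<^bsub>A\<^esub> carrier A"
    then obtain b where b: "b \<in> carrier A" "a = x \<otimes>\<^bsub>A\<^esub> b"
      by (auto simp: l_coset_def)
    show "a \<in> {a \<in> carrier A. x \<otimes>\<^bsub>A\<^esub> a = \<zero>\<^bsub>A\<^esub>}"
      unfolding b(2) using b(1) xA(1,3) by (simp add: R.m_assoc[symmetric])
  next
    fix a assume "a \<in> {a \<in> carrier A. x \<otimes>\<^bsub>A\<^esub> a = \<zero>\<^bsub>A\<^esub>}"
    then have a: "a \<in> carrier A" "x \<otimes>\<^bsub>A\<^esub> a = \<zero>\<^bsub>A\<^esub>"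
      by simp_all
    have aJ: "a \<in> J"
      using annihilator_radical[OF a(1) xA(1,2)] a(2) by simp
    have "\<exists>c\<in>carrier K. \<exists>b\<in>radical_sq A. a = c \<odot>\<^bsub>A\<^esub> x \<oplus>\<^bsub>A\<^esub> b"
    proof (rule radical_map_kernel[OF e, where \<phi> = "\<lambda>a. x \<otimes>\<^bsub>A\<^esub> a"])
      show "x \<otimes>\<^bsub>A\<^esub> b = \<zero>\<^bsub>A\<^esub>" if "b \<in> radical_sq A" for b
        using xJ that by (rule radical_mult_radical_sq)
    qed (use xA(1,3) xJ conca_not_radical_sq[OF e left] onto aJ a(2) in
        \<open>simp_all add: R.r_distr smult_mult_right\<close>)
    then obtain c b where cb: "c \<in> carrier K" "b \<in> radical_sq A" "a = c \<odot>\<^bsub>A\<^esub> x \<oplus>\<^bsub>A\<^esub> b"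
      by (elim bexE)
    have "b \<in> (\<lambda>a. x \<otimes>\<^bsub>A\<^esub> a) ` J"
      unfolding onto by (rule cb(2))
    then obtain j where j: "j \<in> J" "b = x \<otimes>\<^bsub>A\<^esub> j"
      by (elim imageE)
    have "a = x \<otimes>\<^bsub>A\<^esub> (c \<odot>\<^bsub>A\<^esub> \<one>\<^bsub>A\<^esub> \<oplus>\<^bsub>A\<^esub> j)"
      unfolding cb(3) j(2) using cb(1) J_carrier[OF j(1)] xA(1) by (simp add: R.r_distr scalar_mult)
    moreover have "c \<odot>\<^bsub>A\<^esub> \<one>\<^bsub>A\<^esub> \<oplus>\<^bsub>A\<^esub> j \<in> carrier A"
      using cb(1) J_carrier[OF j(1)] by simp
    ultimately show "a \<in> x <#\<^bsub>A\<^esub> carrier A"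
      unfolding l_coset_def by (intro UN_I) simp_all
  qed
qed

end

section \<open>The complex of a Conca element\<close>

lemma left_regular_rank_one_complex:
  assumes "ring A" and "x \<in> carrier A"
  shows "rank_one_complex A (left_regular A) (\<lambda>a. a) (right_mult A x) x"
proof -
  interpret ring A by fact
  show ?thesis
    using assms(2)
    by (intro rank_one_complex.intro rank_one_complex_axioms.intro left_regular_left_module assms(1))
      (simp_all add: lmod_hom_def left_regular_def right_mult_def bij_betw_def)
qed

lemma free_module_rank_one_complex:
  assumes "ring A" and x: "x \<in> carrier A"
  shows "rank_one_complex A (free_module A 1) (\<lambda>f. f 0) (\<lambda>f i. f i \<otimes>\<^bsub>A\<^esub> x) x"
proof -
  interpret ring A by fact
  show ?thesis
    using x
    by (intro rank_one_complex.intro rank_one_complex_axioms.intro free_module_left_module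
        free_module_one_coordinate assms)
      (simp_all add: free_module_def)
qed

text \<open>The complex of right multiplications by \<open>x\<close> is realised on the sequences \<open>A\<^sup>1\<close>, since the
  definition of \<open>gorenstein_projective\<close> asks for modules on the type \<open>nat \<Rightarrow> 'a\<close>. Its images are
  identified with \<open>A x\<close> by \<open>first_coordinate\<close>.\<close>

lemma gorenstein_projective_principal:
  assumes "ring A" and x: "x \<in> carrier A"
    and left: "{a \<in> carrier A. a \<otimes>\<^bsub>A\<^esub> x = \<zero>\<^bsub>A\<^esub>} = carrier A #>\<^bsub>A\<^esub> x"
    and right: "{a \<in> carrier A. x \<otimes>\<^bsub>A\<^esub> a = \<zero>\<^bsub>A\<^esub>} = x <#\<^bsub>A\<^esub> carrier A"
  shows "gorenstein_projective A ((left_regular A)\<lparr>carrier := carrier A #>\<^bsub>A\<^esub> x\<rparr>)"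
proof -
  interpret ring A by fact
  let ?F = "free_module A 1" and ?d = "\<lambda>f i. f i \<otimes>\<^bsub>A\<^esub> x"
  let ?M = "(left_regular A)\<lparr>carrier := carrier A #>\<^bsub>A\<^esub> x\<rparr>"
  interpret LR: left_module A "left_regular A"
    by (rule left_regular_left_module[OF assms(1)])
  interpret F: rank_one_complex A ?F "\<lambda>f. f 0" ?d x
    by (rule free_module_rank_one_complex[OF assms(1) x])
  have "submodule (carrier A #>\<^bsub>A\<^esub> x) A (left_regular A)"
    unfolding left[symmetric]
    by (rule LR.submoduleI) (simp_all add: left_regular_def l_distr m_assoc x subset_iff)
  then have M: "left_module A ?M"
    by (rule LR.submodule_left_module)
  have "lmod_isomorphic A ?F ?F"
    unfolding lmod_isomorphic_def
    by (intro bexI[of _ "\<lambda>f. f"]) (simp_all add: lmod_hom_def bij_betw_def)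
  then have "projective_module A ?F"
    by (intro has_rank_projective[of A ?F 1] free_module_left_module assms(1))
      (simp add: has_rank_def)
  then have ex: "exact_projective_complex A (\<lambda>_. ?F) (\<lambda>_. ?d)"
    using F.exact[OF left] by (simp add: exact_projective_complex_def)
  have fc: "first_coordinate A (a \<otimes>\<^bsub>A\<^esub> x) = ?d (first_coordinate A a)" for a
    using x by (auto simp: first_coordinate_def)
  have fcF: "first_coordinate A a \<in> carrier ?F" if "a \<in> carrier A" for a
    using that by (simp add: first_coordinate_def free_module_def)
  have "first_coordinate A ` (carrier A #>\<^bsub>A\<^esub> x) = ?d ` carrier ?F"
  proof (intro equalityI subsetI)
    fix f assume "f \<in> first_coordinate A ` (carrier A #>\<^bsub>A\<^esub> x)"
    then obtain a where "a \<in> carrier A" "f = first_coordinate A (a \<otimes>\<^bsub>A\<^esub> x)"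
      by (auto simp: r_coset_def)
    then show "f \<in> ?d ` carrier ?F"
      unfolding fc by (metis fcF imageI)
  next
    fix f assume "f \<in> ?d ` carrier ?F"
    then obtain g where g: "g \<in> carrier ?F" "f = ?d g"
      by (elim imageE)
    have "f = first_coordinate A (g 0 \<otimes>\<^bsub>A\<^esub> x)"
      unfolding fc free_module_one_eq[OF g(1)] by (rule g(2))
    moreover have "g 0 \<otimes>\<^bsub>A\<^esub> x \<in> carrier A #>\<^bsub>A\<^esub> x"
      using F.coord(1)[OF g(1)] by (auto simp: r_coset_def)
    ultimately show "f \<in> first_coordinate A ` (carrier A #>\<^bsub>A\<^esub> x)"
      by (rule image_eqI)
  qed
  moreover have "inj_on (first_coordinate A) (carrier A #>\<^bsub>A\<^esub> x)"
    by (intro inj_onI) (metis first_coordinate_def)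
  ultimately have "bij_betw (first_coordinate A) (carrier ?M) (?d ` carrier ?F)"
    by (simp add: bij_betw_def)
  moreover have "first_coordinate A \<in> lmod_hom A ?M (?F\<lparr>carrier := ?d ` carrier ?F\<rparr>)"
  proof -
    have "carrier A #>\<^bsub>A\<^esub> x \<subseteq> carrier A"
      unfolding left[symmetric] by auto
    then show ?thesis
      using lmod_homD(2,3)[OF first_coordinate_hom[OF assms(1)]] bij_betwE[OF calculation]
      by (auto simp: lmod_hom_def left_regular_def subset_iff free_module_def)
  qed
  ultimately have "lmod_isomorphic A ?M (?F\<lparr>carrier := ?d ` carrier ?F\<rparr>)"
    unfolding lmod_isomorphic_def by (intro bexI[of _ "first_coordinate A"]) simp_all
  then show ?thesis
    unfolding gorenstein_projective_def using M ex F.dual_exact[OF right]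
    by (intro conjI exI[of _ "\<lambda>_. ?F"] exI[of _ "\<lambda>_. ?d"] exI[of _ 0])
qed

theorem proposition10p7:
  fixes K :: "'k ring" and A :: "('k, 'a) module" and x :: 'a and e :: nat
    and P :: "int \<Rightarrow> ('a, 'a) module" and d :: "int \<Rightarrow> 'a \<Rightarrow> 'a"
  assumes "short_local_algebra K A"
    and "e \<ge> 2"
    and "hilbert_type A = (enat e, enat (e - 1))"
    and "left_conca A x"
    and "\<And>i. P i = left_regular A"
    and "\<And>i. d i = right_mult A x"
  shows "exact_projective_complex A P d \<and> minimal_complex A P d \<and>
      (\<forall>i. d i ` carrier (P i) = carrier A #>\<^bsub>A\<^esub> x) \<and>
      type_I_complex A P d \<and>
      (conca A x \<longrightarrow>
        dual_exact A P d \<and>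
        gorenstein_projective A ((left_regular A)\<lparr>carrier := carrier A #>\<^bsub>A\<^esub> x\<rparr>))"
proof -
  interpret short_local_algebra K A by fact
  have P: "P = (\<lambda>_. left_regular A)" and d: "d = (\<lambda>_. right_mult A x)"
    using assms(5,6) by (simp_all add: fun_eq_iff)
  have x: "x \<in> carrier A" "x \<noteq> \<zero>\<^bsub>A\<^esub>"
    using assms(4) by (simp_all add: left_conca_def)
  note ker = left_conca_kernel[OF assms(2-4)]
  interpret C: rank_one_complex A "left_regular A" "\<lambda>a. a" "right_mult A x" x
    by (rule left_regular_rank_one_complex[OF ring_A x(1)])
  have rank: "has_rank A (left_regular A) 1"
    by (rule left_regular_has_rank[OF ring_A])
  have ex: "exact_projective_complex A P d"
    using C.exact[OF ker(2)] has_rank_projective[OF left_regular_left_module[OF ring_A] rank]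
    unfolding P d exact_projective_complex_def by simp
  have minimal: "minimal_complex A P d"
    unfolding minimal_complex_def P d
  proof (intro allI subsetI)
    fix b assume "b \<in> right_mult A x ` carrier (left_regular A)"
    then obtain a where a: "a \<in> carrier A" "b = a \<otimes>\<^bsub>A\<^esub> x"
      by (auto simp: right_mult_def left_regular_def)
    have bJ: "b \<in> radical A"
      unfolding a(2) by (rule radical_left_ideal(4)[OF a(1) ker(1)])
    have "b \<odot>\<^bsub>left_regular A\<^esub> \<one>\<^bsub>A\<^esub> \<in> ideal_smult (radical A) (left_regular A)"
      by (rule ideal_smult.smult[OF bJ]) (simp add: left_regular_def)
    then show "b \<in> ideal_smult (radical A) (left_regular A)"
      using J_carrier[OF bJ] by (simp add: left_regular_def)
  qed
  have images: "\<forall>i. d i ` carrier (P i) = carrier A #>\<^bsub>A\<^esub> x"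
    unfolding P d by (auto simp: r_coset_def right_mult_def left_regular_def)
  have "carrier (P 0) \<noteq> {\<zero>\<^bsub>P 0\<^esub>}"
    using x unfolding P by (auto simp: left_regular_def)
  moreover have "\<forall>i. has_rank A (P i) 1"
    unfolding P using rank by simp
  ultimately have "type_I_complex A P d"
    unfolding type_I_complex_def using ex minimal
    by (intro conjI exI[of _ 0] exI[of _ 1])
  moreover have "dual_exact A P d \<and>
      gorenstein_projective A ((left_regular A)\<lparr>carrier := carrier A #>\<^bsub>A\<^esub> x\<rparr>)"
    if "conca A x"
  proof -
    note right = conca_kernel[OF assms(2,3) that]
    show ?thesis
      using C.dual_exact[OF right] gorenstein_projective_principal[OF ring_A x(1) ker(2) right]
      unfolding P d by simp
  qed
  ultimately show ?thesis
    using ex minimal images by simp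
qed

end
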